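(* Let $E$ be an arbitrary directed graph, $K$ a field, $L=L_K(E)$ the Leavitt path algebra of $E$ over $K$, and let $I$ be a proper graded two-sided ideal of $L$. (a) If $I=P_1\cdots P_m$ is an irredundant product of prime ideals $P_i$ of $L$, then all the ideals $P_i$ are graded and $I=P_1\cap\cdots\cap P_m$. (b) If $I=P_1\cdots P_m=Q_1\cdots Q_n$ are two irredundant products of prime ideals $P_i$ and $Q_j$ of $L$, then $m=n$ and $\{P_1,\ldots,P_m\}=\{Q_1,\ldots,Q_m\}$.
   Context: A directed graph $E=(E^0,E^1,r,s)$ consists of sets $E^0$ (vertices) and $E^1$ (edges), of arbitrary cardinality, with maps $r,s:E^1\to E^0$ (range, source). A vertex $v$ is regular if $s^{-1}(v)$ is finite and non-empty. The Leavitt path algebra $L_K(E)$ is the (not necessarily unital) $K$-algebra generated by pairwise orthogonal idempotents $\{v:v\in E^0\}$ and elements $\{e,e^*:e\in E^1\}$ subject to: (1) $s(e)e=e=er(e)$; (2) $r(e)e^*=e^*=e^*s(e)$; (3) $e^*e=r(e)$ and $e^*f=0$ for edges $e\ne f$; (4) $v=\sum_{s(e)=v}ee^*$ for every regular vertex $v$. It is $\mathbb{Z}$-graded, $L=\bigoplus_n L_n$, by $\deg v=0$, $\deg e=1$, $\deg e^*=-1$; an ideal $I$ is graded if $I=\bigoplus_n(I\cap L_n)$. Ideals are two-sided. A proper ideal $P$ is prime if for all two-sided ideals $A,B$, $AB\subseteq P$ implies $A\subseteq P$ or $B\subseteq P$. A product $I=P_1\cdots P_m$ of ideals is irredundant if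 $I$ is not the product of a proper subcollection of these $m$ (indexed) ideals $P_i$. *)

theory Defs
  imports
    "HOL-Library.Poly_Mapping"
    "HOL-Algebra.QuotRing"
    "HOL-Algebra.Ideal_Product"
    "Graph_Theory.Digraph"
begin

text \<open>
  A directed graph is a record of type \<open>pre_digraph\<close> satisfying \<open>wf_digraph\<close>: \<open>verts\<close>, \<open>arcs\<close>,
  \<open>tail\<close> and \<open>head\<close> are \<open>E\<^sup>0\<close>, \<open>E\<^sup>1\<close>, the source map and the range map, without
  cardinality restrictions.
\<close>

definition regular_vertex :: "('v, 'e) pre_digraph \<Rightarrow> 'v \<Rightarrow> bool" where
  "regular_vertex E v \<longleftrightarrow> v \<in> verts E \<and> finite (out_arcs E v) \<and> out_arcs E v \<noteq> {}"


section \<open>The free algebra\<close>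

text \<open>
  The free monoid, written additively because multiplication on \<open>poly_mapping\<close> is convolution
  over an additive monoid; \<open>'a free_monoid \<Rightarrow>\<^sub>0 'k\<close> is the free unital associative
  algebra on all of \<open>'a\<close>.
\<close>

datatype 'a free_monoid = Word (letters: "'a list")

instantiation free_monoid :: (type) monoid_add
begin

definition zero_free_monoid :: "'a free_monoid" where
  "0 = Word []"

definition plus_free_monoid :: "'a free_monoid \<Rightarrow> 'a free_monoid \<Rightarrow> 'a free_monoid" where
  "u + w = Word (letters u @ letters w)"

instance
  by standard (simp_all add: zero_free_monoid_def plus_free_monoid_def)

end

datatype ('v, 'e) generator = Vertex 'v | Edge 'e | Ghost 'e

type_synonym ('v, 'e, 'k) free_alg = "('v, 'e) generator free_monoid \<Rightarrow>\<^sub>0 'k"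

definition generators :: "('v, 'e) pre_digraph \<Rightarrow> ('v, 'e) generator set" where
  "generators E = Vertex ` verts E \<union> Edge ` arcs E \<union> Ghost ` arcs E"

text \<open>
  The free \<^emph>\<open>non-unital\<close> algebra on the generators of \<open>E\<close>: only non-empty words occur.
  The field \<open>one\<close> of the record is a dummy. It is the unit of the ambient unital free algebra,
  does not lie in the carrier, and nothing below depends on it; the same holds for the quotient.
\<close>

definition free_nonunital_alg :: "('v, 'e) pre_digraph \<Rightarrow> ('v, 'e, 'k::field) free_alg ring" where
  "free_nonunital_alg E =
     \<lparr>carrier = {f. \<forall>w\<in>Poly_Mapping.keys f. letters w \<noteq> [] \<and> set (letters w) \<subseteq> generators E},
      mult = (*), one = 1, zero = 0, add = (+)\<rparr>"

definition gen :: "('v, 'e) generator \<Rightarrow> ('v, 'e, 'k::field) free_alg" where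
  "gen x = Poly_Mapping.single (Word [x]) 1"

abbreviation vx :: "'v \<Rightarrow> ('v, 'e, 'k::field) free_alg" where "vx v \<equiv> gen (Vertex v)"
abbreviation ed :: "'e \<Rightarrow> ('v, 'e, 'k::field) free_alg" where "ed e \<equiv> gen (Edge e)"
abbreviation gh :: "'e \<Rightarrow> ('v, 'e, 'k::field) free_alg" where "gh e \<equiv> gen (Ghost e)"

definition scale :: "'k \<Rightarrow> ('v, 'e, 'k::field) free_alg \<Rightarrow> ('v, 'e, 'k) free_alg" where
  "scale c f = Poly_Mapping.single 0 c * f"


section \<open>Ideals of not necessarily unital rings\<close>

text \<open>
  The library's \<open>ideal\<close> presupposes a unital ring and its \<open>primeideal\<close> a commutative one, so
  both notions are stated here for an arbitrary ring record. The product \<open>ideal_prod\<close> (finite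
  sums of products) is the library's.
\<close>

definition two_sided_ideal :: "('a, 'b) ring_scheme \<Rightarrow> 'a set \<Rightarrow> bool" where
  "two_sided_ideal R I \<longleftrightarrow>
     additive_subgroup I R \<and>
     (\<forall>x\<in>I. \<forall>a\<in>carrier R. a \<otimes>\<^bsub>R\<^esub> x \<in> I \<and> x \<otimes>\<^bsub>R\<^esub> a \<in> I)"

definition proper_ideal :: "('a, 'b) ring_scheme \<Rightarrow> 'a set \<Rightarrow> bool" where
  "proper_ideal R I \<longleftrightarrow> two_sided_ideal R I \<and> I \<noteq> carrier R"

definition prime_ideal :: "('a, 'b) ring_scheme \<Rightarrow> 'a set \<Rightarrow> bool" where
  "prime_ideal R P \<longleftrightarrow>
     proper_ideal R P \<and>
     (\<forall>A B. two_sided_ideal R A \<and> two_sided_ideal R B \<and> ideal_prod R A B \<subseteq> P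
        \<longrightarrow> A \<subseteq> P \<or> B \<subseteq> P)"

text \<open>
  \<open>P\<^sub>1 \<cdots> P\<^sub>m\<close>, with the usual convention that the empty product is the whole ring. A separate
  singleton clause is needed because \<open>P \<cdot> R\<close> may differ from \<open>P\<close> in a non-unital ring.
\<close>

fun ideal_list_prod :: "('a, 'b) ring_scheme \<Rightarrow> 'a set list \<Rightarrow> 'a set" where
  "ideal_list_prod R [] = carrier R"
| "ideal_list_prod R [P] = P"
| "ideal_list_prod R (P # Q # Ps) = ideal_prod R P (ideal_list_prod R (Q # Ps))"

text \<open>
  The factors are indexed by their positions in the list, so a repeated ideal counts as several
  factors; a subcollection is a set \<open>S\<close> of positions, multiplied in the given order.
\<close>

definition irredundant_prime_product ::
  "('a, 'b) ring_scheme \<Rightarrow> 'a set \<Rightarrow> 'a set list \<Rightarrow> bool" where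
  "irredundant_prime_product R I Ps \<longleftrightarrow>
     (\<forall>P\<in>set Ps. prime_ideal R P) \<and>
     I = ideal_list_prod R Ps \<and>
     (\<forall>S. S \<subset> {..<length Ps} \<longrightarrow> I \<noteq> ideal_list_prod R (nths Ps S))"

text \<open>
  \<open>I\<close> is the internal direct sum of the groups \<open>I \<inter> L\<^sub>n\<close>: each element of \<open>I\<close> has exactly one
  expression as a sum of a finitely supported family \<open>c\<close> with \<open>c n \<in> I \<inter> L\<^sub>n\<close>. (Such sums lie
  in \<open>I\<close> anyway.)
\<close>

definition graded_ideal :: "('a, 'b) ring_scheme \<Rightarrow> (int \<Rightarrow> 'a set) \<Rightarrow> 'a set \<Rightarrow> bool" where
  "graded_ideal R L I \<longleftrightarrow>
     two_sided_ideal R I \<and>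
     (\<forall>x\<in>I. \<exists>!c. (\<forall>n. c n \<in> I \<inter> L n) \<and> finite {n. c n \<noteq> \<zero>\<^bsub>R\<^esub>} \<and>
        x = finsum R c {n. c n \<noteq> \<zero>\<^bsub>R\<^esub>})"


section \<open>The Leavitt path algebra\<close>

inductive_set leavitt_relators :: "('v, 'e) pre_digraph \<Rightarrow> ('v, 'e, 'k::field) free_alg set"
  for E :: "('v, 'e) pre_digraph" where
  idem: "v \<in> verts E \<Longrightarrow> vx v * vx v - vx v \<in> leavitt_relators E"
| orth: "v \<in> verts E \<Longrightarrow> w \<in> verts E \<Longrightarrow> v \<noteq> w \<Longrightarrow> vx v * vx w \<in> leavitt_relators E"
| source_edge: "e \<in> arcs E \<Longrightarrow> vx (tail E e) * ed e - ed e \<in> leavitt_relators E"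
| edge_range: "e \<in> arcs E \<Longrightarrow> ed e * vx (head E e) - ed e \<in> leavitt_relators E"
| range_ghost: "e \<in> arcs E \<Longrightarrow> vx (head E e) * gh e - gh e \<in> leavitt_relators E"
| ghost_source: "e \<in> arcs E \<Longrightarrow> gh e * vx (tail E e) - gh e \<in> leavitt_relators E"
| CK1_same: "e \<in> arcs E \<Longrightarrow> gh e * ed e - vx (head E e) \<in> leavitt_relators E"
| CK1_distinct: "e \<in> arcs E \<Longrightarrow> f \<in> arcs E \<Longrightarrow> e \<noteq> f \<Longrightarrow> gh e * ed f \<in> leavitt_relators E"
| CK2: "regular_vertex E v \<Longrightarrow>
    vx v - (\<Sum>e\<in>out_arcs E v. ed e * gh e) \<in> leavitt_relators E"

text \<open>
  The algebra ideal generated by the relators. Closure under scalars must be demanded: the free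
  non-unital algebra has no local units, so its ring ideals need not be subspaces.
\<close>

definition leavitt_relation_ideal ::
  "('v, 'e) pre_digraph \<Rightarrow> ('v, 'e, 'k::field) free_alg set" where
  "leavitt_relation_ideal E =
     \<Inter>{J. two_sided_ideal (free_nonunital_alg E) J \<and>
          (\<forall>c. \<forall>f\<in>J. scale c f \<in> J) \<and> leavitt_relators E \<subseteq> J}"

text \<open>
  Elements are cosets. The coefficient field \<open>K\<close> is the type \<open>'k\<close>. Only the underlying ring is
  recorded, and ideals of it are ring ideals; these are the same as algebra ideals because
  \<open>L\<^sub>K(E)\<close> has local units (sums of vertices).
\<close>

definition leavitt_path_algebra ::
  "('v, 'e) pre_digraph \<Rightarrow> ('v, 'e, 'k::field) free_alg set ring" where
  "leavitt_path_algebra E = free_nonunital_alg E Quot leavitt_relation_ideal E"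

primrec gen_degree :: "('v, 'e) generator \<Rightarrow> int" where
  "gen_degree (Vertex v) = 0"
| "gen_degree (Edge e) = 1"
| "gen_degree (Ghost e) = -1"

definition word_degree :: "('v, 'e) generator free_monoid \<Rightarrow> int" where
  "word_degree w = sum_list (map gen_degree (letters w))"

definition leavitt_component ::
  "('v, 'e) pre_digraph \<Rightarrow> int \<Rightarrow> ('v, 'e, 'k::field) free_alg set set" where
  "leavitt_component E n =
     {leavitt_relation_ideal E +>\<^bsub>free_nonunital_alg E\<^esub> f | f.
        f \<in> carrier (free_nonunital_alg E) \<and> (\<forall>w\<in>Poly_Mapping.keys f. word_degree w = n)}"

end

theory Submission
  imports Defs
begin

text \<open>
  For an ideal \<open>P\<close> let \<open>core P\<close> be the largest graded ideal inside \<open>P\<close>. In a \<open>\<int>\<close>-graded ring the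
  core of a prime ideal is prime, by comparing components of highest degree. Graded ideals of
  \<open>L\<^sub>K(E)\<close> are idempotent, so products of graded ideals are intersections. Hence, if the graded
  ideal \<open>I\<close> is \<open>P\<^sub>1 \<cdots> P\<^sub>m\<close>, then \<open>I\<close> is the intersection of the \<open>core P\<^sub>i\<close>. Each minimal \<open>core P\<^sub>i\<close> is a
  prime containing \<open>P\<^sub>1 \<cdots> P\<^sub>m\<close>, hence contains and therefore equals some \<open>P\<^sub>j\<close>; so the product of
  these \<open>P\<^sub>j\<close>, one for each minimal core, is already \<open>I\<close>, and by irredundancy there are no other
  factors. Then the \<open>P\<^sub>i\<close> are the minimal primes over \<open>I\<close>, each occurring once.

  Idempotence: let \<open>A\<close> be graded. Multiplication by edges and ghost edges reduces to degree 0. An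
  element \<open>x\<close> of degree 0 is a combination of terms \<open>v\<close> and \<open>e z f\<^sup>*\<close> with \<open>z\<close> of smaller depth. With
  \<open>p = \<Sum> e e\<^sup>*\<close> over sufficiently many edges, \<open>x - p x p\<close> is a combination of the orthogonal idempotents
  \<open>v - p v\<close>, hence von Neumann regular and in \<open>A\<^sup>2\<close>, while \<open>p x p = \<Sum> e (e\<^sup>* x f) f\<^sup>*\<close> lies in \<open>A\<^sup>2\<close> by
  induction.
\<close>


section \<open>Ideals of nonunital rings\<close>

text \<open>The field \<open>one\<close> of the record is left out of the axioms because in the
  algebras below it lies outside the carrier.\<close>

locale nonunital_ring = abelian_group R for R (structure) +
  assumes m_closed: "x \<in> carrier R \<Longrightarrow> y \<in> carrier R \<Longrightarrow> x \<otimes> y \<in> carrier R"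
    and m_assoc: "x \<in> carrier R \<Longrightarrow> y \<in> carrier R \<Longrightarrow> z \<in> carrier R \<Longrightarrow>
      (x \<otimes> y) \<otimes> z = x \<otimes> (y \<otimes> z)"
    and l_distr: "x \<in> carrier R \<Longrightarrow> y \<in> carrier R \<Longrightarrow> z \<in> carrier R \<Longrightarrow>
      (x \<oplus> y) \<otimes> z = x \<otimes> z \<oplus> y \<otimes> z"
    and r_distr: "x \<in> carrier R \<Longrightarrow> y \<in> carrier R \<Longrightarrow> z \<in> carrier R \<Longrightarrow>
      z \<otimes> (x \<oplus> y) = z \<otimes> x \<oplus> z \<otimes> y"
begin

lemma l_null: assumes "x \<in> carrier R" shows "\<zero> \<otimes> x = \<zero>"
proof -
  have "\<zero> \<otimes> x \<oplus> \<zero> \<otimes> x = \<zero> \<otimes> x \<oplus> \<zero>"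
    using assms by (simp add: l_distr[symmetric] m_closed)
  then show ?thesis using assms by (simp add: m_closed)
qed

lemma minus_mult: assumes "x \<in> carrier R" "y \<in> carrier R" shows "\<ominus> (x \<otimes> y) = (\<ominus> x) \<otimes> y"
proof -
  have "(\<ominus> x) \<otimes> y \<oplus> x \<otimes> y = \<zero>"
    using assms by (simp add: l_distr[symmetric] l_neg l_null)
  then show ?thesis using assms by (simp add: m_closed minus_equality)
qed

lemma two_sided_ideal_iff:
  "two_sided_ideal R I \<longleftrightarrow> I \<subseteq> carrier R \<and> \<zero> \<in> I \<and> (\<forall>x\<in>I. \<forall>y\<in>I. x \<oplus> y \<in> I) \<and> (\<forall>x\<in>I. \<ominus> x \<in> I) \<and>
     (\<forall>x\<in>I. \<forall>a\<in>carrier R. a \<otimes> x \<in> I \<and> x \<otimes> a \<in> I)"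
  unfolding two_sided_ideal_def additive_subgroup_def subgroup_def a_inv_def by auto

lemma ideal_prod_subset:
  assumes "two_sided_ideal R A" "two_sided_ideal R B"
  shows "ideal_prod R A B \<subseteq> A \<inter> B"
proof
  fix x assume "x \<in> ideal_prod R A B"
  then show "x \<in> A \<inter> B"
    by induction (use assms in \<open>auto simp: two_sided_ideal_iff subset_iff\<close>)
qed

lemma ideal_prod_mono:
  assumes "A \<subseteq> A'" "B \<subseteq> B'"
  shows "ideal_prod R A B \<subseteq> ideal_prod R A' B'"
proof
  fix x assume "x \<in> ideal_prod R A B"
  then show "x \<in> ideal_prod R A' B'"
    by induction (use assms in \<open>auto intro: ideal_prod.intros\<close>)
qed

lemma two_sided_ideal_ideal_prod:
  assumes A: "two_sided_ideal R A" and B: "two_sided_ideal R B"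
  shows "two_sided_ideal R (ideal_prod R A B)"
proof -
  have car: "ideal_prod R A B \<subseteq> carrier R"
    using ideal_prod_subset[OF assms] A by (auto simp: two_sided_ideal_iff)
  have zA: "\<zero> \<in> A" and cA: "A \<subseteq> carrier R" and zB: "\<zero> \<in> B" and cB: "B \<subseteq> carrier R"
    using assms by (auto simp: two_sided_ideal_iff)
  have zero: "\<zero> \<in> ideal_prod R A B"
    using ideal_prod.prod[OF zA zB, of R] by (simp add: l_null)
  have neg: "\<ominus> x \<in> ideal_prod R A B" if "x \<in> ideal_prod R A B" for x
    using that
  proof induction
    case (prod i j)
    then have "\<ominus> (i \<otimes> j) = (\<ominus> i) \<otimes> j" using cA cB by (auto intro: minus_mult)
    then show ?case using prod A by (auto simp: two_sided_ideal_iff intro: ideal_prod.prod)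
  next
    case (sum s t)
    then have "\<ominus> (s \<oplus> t) = (\<ominus> s) \<oplus> (\<ominus> t)" using car by (auto intro: minus_add)
    then show ?case using sum by (auto intro: ideal_prod.sum)
  qed
  have mult: "a \<otimes> x \<in> ideal_prod R A B \<and> x \<otimes> a \<in> ideal_prod R A B"
    if "x \<in> ideal_prod R A B" and a: "a \<in> carrier R" for x a
    using that(1)
  proof induction
    case (prod i j)
    have "a \<otimes> (i \<otimes> j) = (a \<otimes> i) \<otimes> j" "(i \<otimes> j) \<otimes> a = i \<otimes> (j \<otimes> a)"
      using prod a cA cB by (auto simp: m_assoc subset_iff)
    moreover have "a \<otimes> i \<in> A" "j \<otimes> a \<in> B" using prod a A B by (auto simp: two_sided_ideal_iff)
    ultimately show ?case using prod by (auto intro: ideal_prod.prod)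
  next
    case (sum s t)
    then show ?case using car a by (auto simp: l_distr r_distr subset_iff intro!: ideal_prod.sum)
  qed
  show ?thesis using car zero neg mult by (auto simp: two_sided_ideal_iff intro: ideal_prod.sum)
qed

lemma two_sided_ideal_carrier: "two_sided_ideal R (carrier R)"
  by (auto simp: two_sided_ideal_iff m_closed)

lemma two_sided_ideal_list_prod:
  "(\<And>P. P \<in> set Ps \<Longrightarrow> two_sided_ideal R P) \<Longrightarrow> two_sided_ideal R (ideal_list_prod R Ps)"
  by (induction R\<equiv>R Ps rule: ideal_list_prod.induct)
    (simp_all add: two_sided_ideal_ideal_prod two_sided_ideal_carrier)

lemma ideal_list_prod_subset:
  "(\<And>P. P \<in> set Ps \<Longrightarrow> two_sided_ideal R P) \<Longrightarrow> P \<in> set Ps \<Longrightarrow> ideal_list_prod R Ps \<subseteq> P"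
proof (induction R\<equiv>R Ps rule: ideal_list_prod.induct)
  case (3 P1 P2 Ps)
  have "ideal_list_prod R (P1 # P2 # Ps) \<subseteq> P1 \<inter> ideal_list_prod R (P2 # Ps)"
    using ideal_prod_subset[of P1 "ideal_list_prod R (P2 # Ps)"]
      two_sided_ideal_list_prod[of "P2 # Ps"] 3(2) by auto
  then show ?case using 3 by (cases "P = P1") auto
qed auto

lemma ideal_list_prod_mono:
  "list_all2 (\<subseteq>) Ps Qs \<Longrightarrow> ideal_list_prod R Ps \<subseteq> ideal_list_prod R Qs"
proof (induction R\<equiv>R Ps arbitrary: Qs rule: ideal_list_prod.induct)
  case (3 P1 P2 Ps)
  from 3(2) obtain Q1 Q2 Qs' where "Qs = Q1 # Q2 # Qs'" "P1 \<subseteq> Q1" "list_all2 (\<subseteq>) (P2 # Ps) (Q2 # Qs')"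
    by (auto simp: list_all2_Cons1)
  with 3(1) show ?case by (simp add: ideal_prod_mono)
qed (auto simp: list_all2_Cons1)

text \<open>Iterates the defining property of a prime along the list. The empty list is excluded by
  properness, since its product is the whole ring.\<close>

lemma prime_ideal_list_prod:
  assumes "prime_ideal R P"
  shows "(\<And>Q. Q \<in> set Qs \<Longrightarrow> two_sided_ideal R Q) \<Longrightarrow> ideal_list_prod R Qs \<subseteq> P \<Longrightarrow> \<exists>Q\<in>set Qs. Q \<subseteq> P"
proof (induction R\<equiv>R Qs rule: ideal_list_prod.induct)
  case 1
  then show ?case using assms by (auto simp: prime_ideal_def proper_ideal_def two_sided_ideal_iff)
next
  case (3 P1 P2 Ps)
  then have "P1 \<subseteq> P \<or> ideal_list_prod R (P2 # Ps) \<subseteq> P"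
    using assms two_sided_ideal_list_prod[of "P2 # Ps"] by (auto simp: prime_ideal_def)
  then show ?case using 3 by auto
qed auto

end

text \<open>Collects what the factorization argument takes from the grading, so that it can be
  carried out with ideals alone. The axioms on \<open>core\<close> make \<open>core P\<close> the
  largest graded ideal inside \<open>P\<close>.\<close>

locale graded_ideal_system = nonunital_ring +
  fixes graded :: "'a set \<Rightarrow> bool" and core :: "'a set \<Rightarrow> 'a set"
  assumes graded_ideal: "graded A \<Longrightarrow> two_sided_ideal R A"
    and graded_Int: "graded A \<Longrightarrow> graded B \<Longrightarrow> graded (A \<inter> B)"
    and graded_idem: "graded A \<Longrightarrow> A \<subseteq> ideal_prod R A A"
    and graded_core: "two_sided_ideal R P \<Longrightarrow> graded (core P)"
    and core_subset: "two_sided_ideal R P \<Longrightarrow> core P \<subseteq> P"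
    and core_greatest: "graded A \<Longrightarrow> A \<subseteq> P \<Longrightarrow> A \<subseteq> core P"
    and prime_core: "prime_ideal R P \<Longrightarrow> prime_ideal R (core P)"
begin

text \<open>The intersection is itself graded, hence inside its own square, which lies in the
  product.\<close>

lemma graded_Int_eq_prod:
  assumes "graded A" "graded B"
  shows "ideal_prod R A B = A \<inter> B"
proof
  have "A \<inter> B \<subseteq> ideal_prod R (A \<inter> B) (A \<inter> B)" by (simp add: graded_Int graded_idem assms)
  also have "\<dots> \<subseteq> ideal_prod R A B" by (simp add: ideal_prod_mono)
  finally show "A \<inter> B \<subseteq> ideal_prod R A B" .
qed (use ideal_prod_subset[OF graded_ideal graded_ideal] assms in blast)

text \<open>Both conclusions are proved together because the step applies
  \<open>graded_Int_eq_prod\<close> to the product of the tail. The product of the empty list is the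
  carrier, whereas its intersection is the whole type.\<close>

lemma graded_list_prod:
  "Ps \<noteq> [] \<Longrightarrow> (\<And>P. P \<in> set Ps \<Longrightarrow> graded P) \<Longrightarrow>
    ideal_list_prod R Ps = \<Inter>(set Ps) \<and> graded (ideal_list_prod R Ps)"
proof (induction R\<equiv>R Ps rule: ideal_list_prod.induct)
  case (3 P Q Ps)
  let ?B = "ideal_list_prod R (Q # Ps)"
  have P: "graded P" using 3(3) by simp
  have IH: "?B = \<Inter>(set (Q # Ps)) \<and> graded ?B" by (rule 3(1)) (use 3(3) in auto)
  then have "ideal_prod R P ?B = P \<inter> ?B" "graded (P \<inter> ?B)"
    using P graded_Int_eq_prod graded_Int by blast+
  then show ?case using IH by simp
qed simp_all

text \<open>Carries out the argument with minimal cores. Distinctness and incomparability of the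
  factors are recorded for the uniqueness proof.\<close>

lemma irredundant_prime_product_graded:
  assumes I: "proper_ideal R I" "graded I" and irr: "irredundant_prime_product R I Ps"
  shows "(\<forall>P\<in>set Ps. graded P) \<and> I = \<Inter>(set Ps) \<and> distinct Ps \<and>
    (\<forall>P\<in>set Ps. \<forall>Q\<in>set Ps. P \<subseteq> Q \<longrightarrow> P = Q)"
proof -
  have prime: "prime_ideal R P" if "P \<in> set Ps" for P
    using irr that by (auto simp: irredundant_prime_product_def)
  then have ideal: "two_sided_ideal R P" if "P \<in> set Ps" for P
    using that by (auto simp: prime_ideal_def proper_ideal_def)
  have I_eq: "I = ideal_list_prod R Ps" using irr by (simp add: irredundant_prime_product_def)
  with I have ne: "Ps \<noteq> []" by (auto simp: proper_ideal_def)
  have sub: "I \<subseteq> P" if "P \<in> set Ps" for P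
    using ideal_list_prod_subset[of Ps P] ideal that I_eq by auto
  \<comment> \<open>The minimal elements among the finitely many cores; they turn out to be exactly
    the factors.\<close>
  define M where "M = {A \<in> core ` set Ps. \<forall>B \<in> core ` set Ps. B \<subseteq> A \<longrightarrow> B = A}"
  have M_sub: "M \<subseteq> set Ps"
  proof
    fix A assume A: "A \<in> M"
    then obtain P where P: "P \<in> set Ps" "A = core P" by (auto simp: M_def)
    have "I \<subseteq> A" using core_greatest[OF I(2) sub] P by simp
    \<comment> \<open>Primeness of the core \<open>A\<close> puts some factor \<open>Q\<close> below
      it. Then \<open>core Q\<close> is a core below the minimal \<open>A\<close>, so
      \<open>core Q = Q = A\<close>.\<close>
    then obtain Q where Q: "Q \<in> set Ps" "Q \<subseteq> A"
      using prime_ideal_list_prod[OF prime_core[OF prime[OF P(1)]], of Ps] ideal I_eq P by auto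
    then have "core Q \<subseteq> Q" "core Q \<subseteq> A" using core_subset ideal by blast+
    moreover have "core Q \<in> core ` set Ps" using Q by simp
    moreover have "\<forall>B\<in>core ` set Ps. B \<subseteq> A \<longrightarrow> B = A" using A unfolding M_def by simp
    ultimately have "core Q = A" by blast
    with Q \<open>core Q \<subseteq> Q\<close> have "A = Q" by blast
    with Q show "A \<in> set Ps" by simp
  qed
  have M_graded: "graded A" if "A \<in> M" for A using that ideal by (auto simp: M_def graded_core)
  have above: "\<exists>A\<in>M. A \<subseteq> B" if B: "B \<in> core ` set Ps" for B
  proof -
    obtain A where "A \<in> core ` set Ps" "A \<subseteq> B" "\<forall>C\<in>core ` set Ps. C \<subseteq> A \<longrightarrow> A = C"
      using finite_has_minimal2[OF finite_imageI[OF finite_set] B] by metis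
    moreover from this have "A \<in> M" unfolding M_def by blast
    ultimately show ?thesis by blast
  qed
  have "I = \<Inter>M"
  proof
    show "I \<subseteq> \<Inter>M" using M_sub sub by blast
    \<comment> \<open>The intersection of all cores is their product, which lies in the product of
      the \<open>Ps\<close>.\<close>
    have "\<Inter>M \<subseteq> \<Inter>(set (map core Ps))" using above by fastforce
    also have "\<dots> = ideal_list_prod R (map core Ps)"
    proof -
      have "graded P" if "P \<in> set (map core Ps)" for P using that ideal graded_core by auto
      then show ?thesis using graded_list_prod[of "map core Ps"] ne by blast
    qed
    also have "\<dots> \<subseteq> I" unfolding I_eq
      by (rule ideal_list_prod_mono) (simp add: list_all2_conv_all_nth core_subset ideal)
    finally show "\<Inter>M \<subseteq> I" .
  qed
  have "\<forall>A\<in>M. \<exists>i. i < length Ps \<and> Ps ! i = A" using M_sub by (metis in_set_conv_nth subsetD)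
  \<comment> \<open>One position is selected for each minimal core. The selected factors already
    have product \<open>I\<close>, so irredundancy forces the selection to exhaust all
    positions.\<close>
  then obtain ix where ix: "\<And>A. A \<in> M \<Longrightarrow> ix A < length Ps \<and> Ps ! ix A = A" by metis
  define S where "S = ix ` M"
  have set_nths: "set (nths Ps S) = M" using ix by (force simp: set_nths S_def)
  have "M \<noteq> {}" using above ne by fastforce
  then have "nths Ps S \<noteq> []" using set_nths by force
  then have "ideal_list_prod R (nths Ps S) = I"
    using graded_list_prod[of "nths Ps S"] M_graded set_nths \<open>I = \<Inter>M\<close> by simp
  then have "\<not> S \<subset> {..<length Ps}" using irr unfolding irredundant_prime_product_def by metis
  moreover have "S \<subseteq> {..<length Ps}" using ix by (auto simp: S_def)
  ultimately have S: "S = {..<length Ps}" by blast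
  then have M: "M = set Ps" using set_nths by (simp add: nths_all)
  \<comment> \<open>Every position is the selected position of some ideal in \<open>M\<close>, so
    equal ideals sit at equal positions.\<close>
  have "distinct Ps" unfolding distinct_conv_nth
  proof (intro allI impI)
    fix i j assume "i < length Ps" "j < length Ps" "i \<noteq> j"
    then obtain A B where "A \<in> M" "B \<in> M" "i = ix A" "j = ix B" using S unfolding S_def by blast
    then show "Ps ! i \<noteq> Ps ! j" using ix \<open>i \<noteq> j\<close> by metis
  qed
  moreover have "\<forall>P\<in>M. \<forall>Q\<in>M. P \<subseteq> Q \<longrightarrow> P = Q" unfolding M_def by blast
  ultimately show ?thesis using M M_graded \<open>I = \<Inter>M\<close> by simp
qed

text \<open>\<open>P\<close> lies above some factor \<open>Q\<close> of the second product, and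
  \<open>Q\<close> above some factor \<open>P'\<close> of the first. Incomparability within the
  first product collapses the chain to \<open>P' = Q = P\<close>.\<close>

lemma irredundant_prime_products_set_subset:
  assumes I: "proper_ideal R I" "graded I"
    and irr: "irredundant_prime_product R I Ps" "irredundant_prime_product R I Qs"
  shows "set Ps \<subseteq> set Qs"
proof
  fix P assume P: "P \<in> set Ps"
  have "\<forall>P\<in>set Ps. prime_ideal R P" "\<forall>Q\<in>set Qs. prime_ideal R Q"
    and eq: "I = ideal_list_prod R Ps" "I = ideal_list_prod R Qs"
    using irr by (auto simp: irredundant_prime_product_def)
  then have prime: "prime_ideal R P" "\<And>Q. Q \<in> set Qs \<Longrightarrow> prime_ideal R Q"
    and ideal: "\<And>P. P \<in> set Ps \<Longrightarrow> two_sided_ideal R P" "\<And>Q. Q \<in> set Qs \<Longrightarrow> two_sided_ideal R Q"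
    using P by (auto simp: prime_ideal_def proper_ideal_def)
  have "I \<subseteq> P" using ideal_list_prod_subset[OF ideal(1) P] eq by auto
  then obtain Q where Q: "Q \<in> set Qs" "Q \<subseteq> P"
    using prime_ideal_list_prod[OF prime(1), of Qs] ideal(2) eq by auto
  have "I \<subseteq> Q" using ideal_list_prod_subset[OF ideal(2) Q(1)] eq by auto
  then obtain P' where P': "P' \<in> set Ps" "P' \<subseteq> Q"
    using prime_ideal_list_prod[OF prime(2)[OF Q(1)], of Ps] ideal(1) eq by auto
  have "P' = P" using irredundant_prime_product_graded[OF I irr(1)] P P' Q by blast
  with P' Q show "P \<in> set Qs" by auto
qed

theorem irredundant_prime_products_unique:
  assumes I: "proper_ideal R I" "graded I"
    and irr: "irredundant_prime_product R I Ps" "irredundant_prime_product R I Qs"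
  shows "length Ps = length Qs \<and> set Ps = set Qs"
proof -
  have eq: "set Ps = set Qs"
    using irredundant_prime_products_set_subset I irr by blast
  have "distinct Ps" "distinct Qs"
    using irredundant_prime_product_graded[OF I] irr by blast+
  with eq show ?thesis by (metis distinct_card)
qed

end

section \<open>The grading of the free algebra\<close>

text \<open>The case \<open>single\<close> keeps the keys and coefficients of the given
  \<open>f\<close>, so facts about the words of \<open>f\<close> remain available in an induction on
  it.\<close>

lemma poly_mapping_keys_induct [consumes 0, case_names zero single add]:
  fixes f :: "'a \<Rightarrow>\<^sub>0 'b::comm_monoid_add"
  assumes "P 0" "\<And>w. w \<in> Poly_Mapping.keys f \<Longrightarrow> P (Poly_Mapping.single w (Poly_Mapping.lookup f w))"
    and "\<And>g h. P g \<Longrightarrow> P h \<Longrightarrow> P (g + h)"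
  shows "P f"
proof -
  have "P (\<Sum>w\<in>S. Poly_Mapping.single w (Poly_Mapping.lookup f w))" if "finite S" "S \<subseteq> Poly_Mapping.keys f" for S
    using that by induction (use assms in auto)
  moreover have "(\<Sum>w\<in>Poly_Mapping.keys f. Poly_Mapping.single w (Poly_Mapping.lookup f w)) = f"
    by (rule poly_mapping_eqI) (simp add: lookup_sum lookup_single when_def sum.delta in_keys_iff)
  ultimately show ?thesis by (metis finite_keys order_refl)
qed

lift_definition degree_part :: "int \<Rightarrow> ('v, 'e, 'k::field) free_alg \<Rightarrow> ('v, 'e, 'k) free_alg"
  is "\<lambda>n f w. if word_degree w = n then f w else 0"
  by (auto elim!: rev_finite_subset)

lemma lookup_degree_part:
  "Poly_Mapping.lookup (degree_part n f) w = (if word_degree w = n then Poly_Mapping.lookup f w else 0)"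
  by transfer simp

lemma degree_part_0 [simp]: "degree_part n 0 = 0"
  and degree_part_add: "degree_part n (f + g) = degree_part n f + degree_part n g"
  and degree_part_uminus: "degree_part n (- f) = - degree_part n f"
  and degree_part_diff: "degree_part n (f - g) = degree_part n f - degree_part n g"
  by (auto intro!: poly_mapping_eqI simp: lookup_degree_part lookup_add lookup_minus)

lemma degree_part_sum: "degree_part n (sum f A) = (\<Sum>x\<in>A. degree_part n (f x))"
  by (auto intro!: poly_mapping_eqI simp: lookup_degree_part lookup_sum)

lemma keys_degree_part: "Poly_Mapping.keys (degree_part n f) = {w \<in> Poly_Mapping.keys f. word_degree w = n}"
  by (auto simp: in_keys_iff lookup_degree_part split: if_splits)

definition homogeneous :: "int \<Rightarrow> ('v, 'e, 'k::field) free_alg \<Rightarrow> bool" where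
  "homogeneous n f \<longleftrightarrow> (\<forall>w\<in>Poly_Mapping.keys f. word_degree w = n)"

lemma homogeneous_degree_part: "homogeneous n (degree_part n f)"
  by (simp add: homogeneous_def keys_degree_part)

lemma degree_part_homogeneous: "homogeneous m f \<Longrightarrow> degree_part n f = (if n = m then f else 0)"
  by (rule poly_mapping_eqI) (auto simp: homogeneous_def lookup_degree_part in_keys_iff)

lemma word_degree_0 [simp]: "word_degree 0 = 0"
  and word_degree_add [simp]: "word_degree (u + w) = word_degree u + word_degree w"
  and word_degree_Word [simp]: "word_degree (Word xs) = sum_list (map gen_degree xs)"
  by (simp_all add: word_degree_def zero_free_monoid_def plus_free_monoid_def)

lemma homogeneous_0 [simp]: "homogeneous n 0"
  by (simp add: homogeneous_def)

lemma homogeneous_single: "word_degree w = n \<Longrightarrow> homogeneous n (Poly_Mapping.single w c)"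
  by (simp add: homogeneous_def)

lemma homogeneous_gen: "homogeneous (gen_degree x) (gen x)"
  by (simp add: homogeneous_single gen_def)

lemma homogeneous_mult: "homogeneous m f \<Longrightarrow> homogeneous n g \<Longrightarrow> homogeneous (m + n) (f * g)"
  using keys_mult[of f g] unfolding homogeneous_def by fastforce

lemma homogeneous_add: "homogeneous n f \<Longrightarrow> homogeneous n g \<Longrightarrow> homogeneous n (f + g)"
  using keys_add[of f g] unfolding homogeneous_def by fastforce

lemma homogeneous_sum: "(\<And>x. x \<in> A \<Longrightarrow> homogeneous n (f x)) \<Longrightarrow> homogeneous n (sum f A)"
  by (induction A rule: infinite_finite_induct) (auto intro: homogeneous_add)

lemma homogeneous_diff: "homogeneous n f \<Longrightarrow> homogeneous n g \<Longrightarrow> homogeneous n (f - g)"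
  using homogeneous_add[of n f "- g"] by (simp add: homogeneous_def in_keys_iff)

lemma degree_part_outside: "n \<notin> word_degree ` Poly_Mapping.keys f \<Longrightarrow> degree_part n f = 0"
  by (rule poly_mapping_eqI) (auto simp: lookup_degree_part in_keys_iff)

lemma sum_degree_part:
  assumes "finite D" "word_degree ` Poly_Mapping.keys f \<subseteq> D"
  shows "(\<Sum>n\<in>D. degree_part n f) = f"
proof (rule poly_mapping_eqI)
  fix w
  have "Poly_Mapping.lookup f w = 0" if "word_degree w \<notin> D" using assms(2) that
    by (metis image_subset_iff in_keys_iff)
  then show "Poly_Mapping.lookup (\<Sum>n\<in>D. degree_part n f) w = Poly_Mapping.lookup f w"
    using assms(1) by (auto simp: lookup_sum lookup_degree_part)
qed

lemma degree_part_mult_left: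
  assumes "homogeneous m f"
  shows "degree_part n (f * g) = f * degree_part (n - m) g"
proof -
  \<comment> \<open>The index \<open>n - m\<close> is inserted so that the sum below collapses to it
    even when \<open>g\<close> has no word of that degree.\<close>
  let ?D = "insert (n - m) (word_degree ` Poly_Mapping.keys g)"
  have "degree_part n (f * g) = degree_part n (f * (\<Sum>i\<in>?D. degree_part i g))"
    by (subst sum_degree_part) auto
  also have "\<dots> = (\<Sum>i\<in>?D. degree_part n (f * degree_part i g))"
    by (simp only: sum_distrib_left degree_part_sum)
  also have "\<dots> = (\<Sum>i\<in>?D. if i = n - m then f * degree_part i g else 0)"
    by (rule sum.cong) (auto simp: degree_part_homogeneous[OF homogeneous_mult[OF assms homogeneous_degree_part]])
  finally show ?thesis by (simp add: sum.delta del: sum.insert)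
qed

lemma degree_part_mult_right:
  assumes "homogeneous m g"
  shows "degree_part n (f * g) = degree_part (n - m) f * g"
proof -
  let ?D = "insert (n - m) (word_degree ` Poly_Mapping.keys f)"
  have "degree_part n (f * g) = degree_part n ((\<Sum>i\<in>?D. degree_part i f) * g)"
    by (subst sum_degree_part) auto
  also have "\<dots> = (\<Sum>i\<in>?D. degree_part n (degree_part i f * g))"
    by (simp only: sum_distrib_right degree_part_sum)
  also have "\<dots> = (\<Sum>i\<in>?D. if i = n - m then degree_part i f * g else 0)"
    by (rule sum.cong) (auto simp: degree_part_homogeneous[OF homogeneous_mult[OF homogeneous_degree_part assms]])
  finally show ?thesis by (simp add: sum.delta del: sum.insert)
qed

text \<open>The convolution formula. The finite index set comes from the first factor here and from
  the second in \<open>degree_part_mult'\<close>.\<close>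

lemma degree_part_mult:
  "degree_part n (f * g) = (\<Sum>i\<in>word_degree ` Poly_Mapping.keys f. degree_part i f * degree_part (n - i) g)"
proof -
  have "degree_part n (f * g) = degree_part n ((\<Sum>i\<in>word_degree ` Poly_Mapping.keys f. degree_part i f) * g)"
    by (subst sum_degree_part) auto
  then show ?thesis
    by (simp add: sum_distrib_right degree_part_sum degree_part_mult_left[OF homogeneous_degree_part])
qed

lemma degree_part_mult':
  "degree_part n (f * g) = (\<Sum>i\<in>word_degree ` Poly_Mapping.keys g. degree_part (n - i) f * degree_part i g)"
proof -
  have "degree_part n (f * g) = degree_part n (f * (\<Sum>i\<in>word_degree ` Poly_Mapping.keys g. degree_part i g))"
    by (subst sum_degree_part) auto
  then show ?thesis
    by (simp add: sum_distrib_left degree_part_sum degree_part_mult_right[OF homogeneous_degree_part])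
qed


section \<open>The relation ideal\<close>

abbreviation free_carrier :: "('v, 'e) pre_digraph \<Rightarrow> ('v, 'e, 'k::field) free_alg set" where
  "free_carrier E \<equiv> carrier (free_nonunital_alg E)"

lemma free_carrier_iff:
  "f \<in> free_carrier E \<longleftrightarrow> (\<forall>w\<in>Poly_Mapping.keys f. letters w \<noteq> [] \<and> set (letters w) \<subseteq> generators E)"
  by (simp add: free_nonunital_alg_def)

lemma free_carrier_0: "0 \<in> free_carrier E"
  by (simp add: free_carrier_iff)

lemma free_carrier_add: "f \<in> free_carrier E \<Longrightarrow> g \<in> free_carrier E \<Longrightarrow> f + g \<in> free_carrier E"
  using keys_add[of f g] unfolding free_carrier_iff by blast

lemma free_carrier_uminus: "f \<in> free_carrier E \<Longrightarrow> - f \<in> free_carrier E"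
  by (simp add: free_carrier_iff in_keys_iff)

lemma free_carrier_diff: "f \<in> free_carrier E \<Longrightarrow> g \<in> free_carrier E \<Longrightarrow> f - g \<in> free_carrier E"
  using free_carrier_add[of f E "- g"] free_carrier_uminus[of g E] by simp

lemma free_carrier_mult: "f \<in> free_carrier E \<Longrightarrow> g \<in> free_carrier E \<Longrightarrow> f * g \<in> free_carrier E"
  using keys_mult[of f g] unfolding free_carrier_iff by (fastforce simp: plus_free_monoid_def)

lemma free_carrier_sum: "(\<And>x. x \<in> A \<Longrightarrow> f x \<in> free_carrier E) \<Longrightarrow> sum f A \<in> free_carrier E"
  by (induction A rule: infinite_finite_induct) (auto intro: free_carrier_0 free_carrier_add)

lemma free_carrier_scale: "f \<in> free_carrier E \<Longrightarrow> scale c f \<in> free_carrier E"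
  using keys_mult[of "Poly_Mapping.single 0 c" f] unfolding free_carrier_iff scale_def
  by (fastforce split: if_splits)

lemma free_carrier_degree_part: "f \<in> free_carrier E \<Longrightarrow> degree_part n f \<in> free_carrier E"
  by (simp add: free_carrier_iff keys_degree_part)

lemma free_carrier_single:
  "xs \<noteq> [] \<Longrightarrow> set xs \<subseteq> generators E \<Longrightarrow> Poly_Mapping.single (Word xs) c \<in> free_carrier E"
  by (simp add: free_carrier_iff)

lemma free_carrier_gen: "x \<in> generators E \<Longrightarrow> gen x \<in> free_carrier E"
  by (simp add: gen_def free_carrier_single)

lemmas free_carrier_closed = free_carrier_0 free_carrier_add free_carrier_uminus free_carrier_diff
  free_carrier_mult free_carrier_sum free_carrier_scale free_carrier_degree_part free_carrier_gen

lemma free_nonunital_alg_simps: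
  "mult (free_nonunital_alg E) = (*)" "add (free_nonunital_alg E) = (+)" "zero (free_nonunital_alg E) = 0"
  by (simp_all add: free_nonunital_alg_def)

lemma nonunital_ring_free_nonunital_alg: "nonunital_ring (free_nonunital_alg E :: ('v, 'e, 'k::field) free_alg ring)"
proof -
  have "abelian_group (free_nonunital_alg E :: ('v, 'e, 'k) free_alg ring)"
  proof (rule abelian_groupI)
    fix x :: "('v, 'e, 'k) free_alg"
    assume "x \<in> free_carrier E"
    then show "\<exists>y\<in>free_carrier E. y \<oplus>\<^bsub>free_nonunital_alg E\<^esub> x = \<zero>\<^bsub>free_nonunital_alg E\<^esub>"
      by (intro bexI[of _ "- x"]) (simp_all add: free_carrier_uminus free_nonunital_alg_simps)
  qed (simp_all add: free_carrier_add free_carrier_0 free_nonunital_alg_simps add_ac)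
  then show ?thesis
    by (simp add: nonunital_ring_def nonunital_ring_axioms_def free_nonunital_alg_simps
        free_carrier_mult algebra_simps)
qed

lemma a_inv_free_nonunital_alg: "x \<in> free_carrier E \<Longrightarrow> a_inv (free_nonunital_alg E) x = - x"
  by (rule abelian_group.minus_equality)
    (simp_all add: nonunital_ring.axioms(1)[OF nonunital_ring_free_nonunital_alg] free_carrier_uminus
      free_nonunital_alg_simps)

lemma two_sided_ideal_free_iff:
  "two_sided_ideal (free_nonunital_alg E) J \<longleftrightarrow>
    J \<subseteq> free_carrier E \<and> 0 \<in> J \<and> (\<forall>x\<in>J. \<forall>y\<in>J. x + y \<in> J) \<and> (\<forall>x\<in>J. - x \<in> J) \<and>
    (\<forall>x\<in>J. \<forall>a\<in>free_carrier E. a * x \<in> J \<and> x * a \<in> J)"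
proof -
  have "(\<forall>x\<in>J. a_inv (free_nonunital_alg E) x \<in> J) \<longleftrightarrow> (\<forall>x\<in>J. - x \<in> J)" if "J \<subseteq> free_carrier E"
    using that by (intro ball_cong) (simp_all add: a_inv_free_nonunital_alg subset_iff)
  then show ?thesis
    unfolding nonunital_ring.two_sided_ideal_iff[OF nonunital_ring_free_nonunital_alg] free_nonunital_alg_simps
    by blast
qed

context
  fixes E :: "('v, 'e) pre_digraph" and J :: "('v, 'e, 'k::field) free_alg set"
  defines "J \<equiv> leavitt_relation_ideal E"
begin

lemma relation_ideal_0: "0 \<in> J"
  and relation_ideal_add: "x \<in> J \<Longrightarrow> y \<in> J \<Longrightarrow> x + y \<in> J"
  and relation_ideal_uminus: "x \<in> J \<Longrightarrow> - x \<in> J"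
  and relation_ideal_mult_left: "x \<in> J \<Longrightarrow> a \<in> free_carrier E \<Longrightarrow> a * x \<in> J"
  and relation_ideal_mult_right: "x \<in> J \<Longrightarrow> a \<in> free_carrier E \<Longrightarrow> x * a \<in> J"
  and relation_ideal_scale: "x \<in> J \<Longrightarrow> scale c x \<in> J"
  and relator_in_relation_ideal: "r \<in> leavitt_relators E \<Longrightarrow> r \<in> J"
  by (auto simp: J_def leavitt_relation_ideal_def two_sided_ideal_free_iff)

lemma relation_ideal_diff: "x \<in> J \<Longrightarrow> y \<in> J \<Longrightarrow> x - y \<in> J"
  using relation_ideal_add[of x "- y"] relation_ideal_uminus[of y] by simp

lemma relation_ideal_sum: "(\<And>x. x \<in> A \<Longrightarrow> f x \<in> J) \<Longrightarrow> sum f A \<in> J"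
  by (induction A rule: infinite_finite_induct) (auto intro: relation_ideal_0 relation_ideal_add)

end

text \<open>Acts as an induction principle: a property of all elements of the relation ideal is
  shown by checking that it defines an ideal closed under scalars and containing the
  relators.\<close>

lemma relation_ideal_least:
  assumes "two_sided_ideal (free_nonunital_alg E) J" "\<And>c f. f \<in> J \<Longrightarrow> scale c f \<in> J"
    and "leavitt_relators E \<subseteq> J"
  shows "leavitt_relation_ideal E \<subseteq> J"
  using assms by (auto simp: leavitt_relation_ideal_def)

lemma (in wf_digraph) generators_simps [simp]:
  "v \<in> verts G \<Longrightarrow> Vertex v \<in> generators G" "e \<in> arcs G \<Longrightarrow> Edge e \<in> generators G"
  "e \<in> arcs G \<Longrightarrow> Ghost e \<in> generators G"
  by (auto simp: generators_def)

lemma (in wf_digraph) relators_subset: "leavitt_relators G \<subseteq> free_carrier G"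
proof
  fix r :: "('a, 'b, 'k::field) free_alg"
  assume "r \<in> leavitt_relators G"
  then show "r \<in> free_carrier G"
    by cases (auto intro!: free_carrier_closed simp: regular_vertex_def out_arcs_def)
qed

text \<open>Each relation equates terms of the same degree; in \<open>CK1_same\<close> and
  \<open>CK2\<close> the degrees of an edge and its ghost cancel to 0, the degree of a
  vertex.\<close>

lemma relator_homogeneous:
  fixes r :: "('v, 'e, 'k::field) free_alg"
  assumes "r \<in> leavitt_relators E"
  shows "\<exists>n. homogeneous n r"
proof -
  have v: "homogeneous 0 (vx v :: ('v, 'e, 'k) free_alg)" for v
    using homogeneous_gen[of "Vertex v"] by simp
  have e: "homogeneous 1 (ed e :: ('v, 'e, 'k) free_alg)" for e
    using homogeneous_gen[of "Edge e"] by simp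
  have g: "homogeneous (-1) (gh e :: ('v, 'e, 'k) free_alg)" for e
    using homogeneous_gen[of "Ghost e"] by simp
  note m = homogeneous_mult[OF v v, simplified] homogeneous_mult[OF v e, simplified]
    homogeneous_mult[OF e v, simplified] homogeneous_mult[OF v g, simplified]
    homogeneous_mult[OF g v, simplified] homogeneous_mult[OF g e, simplified]
    homogeneous_mult[OF e g, simplified]
  from assms show ?thesis
    by cases (blast intro: homogeneous_diff homogeneous_sum m v e g)+
qed

context wf_digraph
begin

lemma relation_ideal_subset: "leavitt_relation_ideal G \<subseteq> free_carrier G"
  by (rule relation_ideal_least)
    (auto simp: two_sided_ideal_free_iff relators_subset[THEN subsetD] intro: free_carrier_closed)

text \<open>The elements all of whose components lie in the relation ideal form an ideal closed
  under scalars and containing the relators, so they include the whole relation ideal. Hence the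
  grading descends to the quotient.\<close>

lemma degree_part_relation_ideal:
  fixes f :: "('a, 'b, 'k::field) free_alg"
  assumes "f \<in> leavitt_relation_ideal G"
  shows "degree_part n f \<in> leavitt_relation_ideal G"
proof -
  let ?J = "leavitt_relation_ideal G"
  let ?J' = "{f :: ('a, 'b, 'k) free_alg. f \<in> free_carrier G \<and> (\<forall>n. degree_part n f \<in> ?J)}"
  have left: "degree_part n (a * x) \<in> ?J" if "x \<in> ?J'" "a \<in> free_carrier G" for a x n
    using that unfolding degree_part_mult
    by (auto intro!: relation_ideal_sum relation_ideal_mult_left free_carrier_degree_part)
  have right: "degree_part n (x * a) \<in> ?J" if "x \<in> ?J'" "a \<in> free_carrier G" for a x n
    using that unfolding degree_part_mult'
    by (auto intro!: relation_ideal_sum relation_ideal_mult_right free_carrier_degree_part)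
  have "?J \<subseteq> ?J'"
  proof (rule relation_ideal_least)
    show "two_sided_ideal (free_nonunital_alg G) ?J'"
      using left right unfolding two_sided_ideal_free_iff
      by (auto simp: degree_part_add degree_part_uminus
          intro: free_carrier_closed relation_ideal_0 relation_ideal_add relation_ideal_uminus)
  next
    fix c and f :: "('a, 'b, 'k) free_alg"
    have "degree_part n (scale c f) = scale c (degree_part n f)" for n
      by (simp add: scale_def degree_part_mult_left[of 0] homogeneous_single)
    then show "scale c f \<in> ?J'" if "f \<in> ?J'" using that by (simp add: free_carrier_scale relation_ideal_scale)
  next
    show "leavitt_relators G \<subseteq> ?J'"
    proof
      fix r :: "('a, 'b, 'k) free_alg" assume r: "r \<in> leavitt_relators G"
      then obtain m where "homogeneous m r" using relator_homogeneous by blast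
      then show "r \<in> ?J'"
        using r relators_subset by (auto simp: degree_part_homogeneous relation_ideal_0 relator_in_relation_ideal)
    qed
  qed
  then show ?thesis using assms by blast
qed

end

section \<open>Leavitt path algebras inside a ring type\<close>

text \<open>
  A type cannot depend on the graph, so the ring type below is the product of the Leavitt path
  algebras of all graphs on the given types; \<open>cls E\<close> maps into the factor of \<open>E\<close>. It makes
  type-class algebra available for computations in \<open>L\<^sub>K(E)\<close>.
\<close>

definition leavitt_rel ::
  "(('v, 'e) pre_digraph \<Rightarrow> ('v, 'e, 'k::field) free_alg) \<Rightarrow>
   (('v, 'e) pre_digraph \<Rightarrow> ('v, 'e, 'k) free_alg) \<Rightarrow> bool" where
  "leavitt_rel f g \<longleftrightarrow>
    (\<forall>E. f E \<in> free_carrier E \<and> g E \<in> free_carrier E \<and> f E - g E \<in> leavitt_relation_ideal E)"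

lemma part_equivp_leavitt_rel: "part_equivp (leavitt_rel :: (('v, 'e) pre_digraph \<Rightarrow> ('v, 'e, 'k::field) free_alg) \<Rightarrow> _)"
  (is "part_equivp ?R")
proof (rule part_equivpI)
  show "\<exists>x. ?R x x"
    by (rule exI[of _ "\<lambda>_. 0"]) (simp add: leavitt_rel_def free_carrier_0 relation_ideal_0)
  show "symp ?R"
  proof (rule sympI)
    fix f g :: "('v, 'e) pre_digraph \<Rightarrow> ('v, 'e, 'k) free_alg"
    assume "leavitt_rel f g"
    then show "leavitt_rel g f"
      using relation_ideal_uminus[of "f E - g E" E for E] by (simp add: leavitt_rel_def)
  qed
  show "transp ?R"
  proof (rule transpI)
    fix f g h :: "('v, 'e) pre_digraph \<Rightarrow> ('v, 'e, 'k) free_alg"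
    assume "leavitt_rel f g" "leavitt_rel g h"
    then show "leavitt_rel f h"
      using relation_ideal_add[of "f E - g E" E "g E - h E" for E] by (simp add: leavitt_rel_def)
  qed
qed

quotient_type (overloaded) ('v, 'e, 'k) leavitt =
  "('v, 'e) pre_digraph \<Rightarrow> ('v, 'e, 'k::field) free_alg" / partial: leavitt_rel
  by (rule part_equivp_leavitt_rel)

instantiation leavitt :: (type, type, field) ring
begin

lift_definition zero_leavitt :: "('a, 'b, 'c) leavitt" is "\<lambda>_. 0"
  by (simp add: leavitt_rel_def free_carrier_0 relation_ideal_0)

lift_definition plus_leavitt :: "('a, 'b, 'c) leavitt \<Rightarrow> ('a, 'b, 'c) leavitt \<Rightarrow> ('a, 'b, 'c) leavitt"
  is "\<lambda>f g E. f E + g E"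
  by (simp add: leavitt_rel_def free_carrier_add add_diff_add relation_ideal_add)

lift_definition uminus_leavitt :: "('a, 'b, 'c) leavitt \<Rightarrow> ('a, 'b, 'c) leavitt" is "\<lambda>f E. - f E"
  subgoal for f g
    using relation_ideal_uminus[of "f E - g E" E for E] by (simp add: leavitt_rel_def free_carrier_uminus)
  done

lift_definition minus_leavitt :: "('a, 'b, 'c) leavitt \<Rightarrow> ('a, 'b, 'c) leavitt \<Rightarrow> ('a, 'b, 'c) leavitt"
  is "\<lambda>f g E. f E - g E"
  subgoal for f f' g g'
    using relation_ideal_diff[of "f E - f' E" E "g E - g' E" for E]
    by (simp add: leavitt_rel_def free_carrier_diff algebra_simps)
  done

lift_definition times_leavitt :: "('a, 'b, 'c) leavitt \<Rightarrow> ('a, 'b, 'c) leavitt \<Rightarrow> ('a, 'b, 'c) leavitt"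
  is "\<lambda>f g E. f E * g E"
  subgoal premises prems for f f' g g'
    unfolding leavitt_rel_def
  proof (intro allI conjI)
    fix E
    have "f E * g E - f' E * g' E = f E * (g E - g' E) + (f E - f' E) * g' E"
      by (simp add: algebra_simps)
    then show "f E * g E - f' E * g' E \<in> leavitt_relation_ideal E"
      using prems unfolding leavitt_rel_def
      by (simp add: relation_ideal_add relation_ideal_mult_left relation_ideal_mult_right)
  qed (use prems in \<open>auto simp: leavitt_rel_def free_carrier_mult\<close>)
  done

instance
  by (standard; transfer)
    (simp_all add: leavitt_rel_def free_carrier_closed relation_ideal_0 algebra_simps)

end

text \<open>Scalars sit on the empty word, which commutes with every word.\<close>

lemma single_0_mult_commute: "Poly_Mapping.single 0 c * f = f * (Poly_Mapping.single 0 c :: 'a::monoid_add \<Rightarrow>\<^sub>0 'k::field)"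
  by (induction f rule: poly_mapping_keys_induct) (simp_all add: mult_single mult.commute algebra_simps)

lemma scale_simps:
  "scale c (f + g) = scale c f + scale c g" "scale c (f - g) = scale c f - scale c g" "scale (c + d) f = scale c f + scale d f"
  "scale c (scale d f) = scale (c * d) f" "scale 1 f = f" "scale 0 f = 0"
  "scale c f * g = scale c (f * g)" "f * scale c g = scale c (f * g)"
proof -
  show "f * scale c g = scale c (f * g)"
    by (simp add: scale_def single_0_mult_commute[of c f] flip: mult.assoc)
qed (simp_all add: scale_def single_add mult_single distrib_left distrib_right right_diff_distrib
    flip: mult.assoc)

lemma scale_0: "scale c 0 = 0"
  by (simp add: scale_def)

text \<open>The ring record of the algebra forgets the scalars. The ring type keeps them, for linear
  combinations of monomials and for inverting coefficients.\<close>

lift_definition smult :: "'k::field \<Rightarrow> ('v, 'e, 'k) leavitt \<Rightarrow> ('v, 'e, 'k) leavitt"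
  is "\<lambda>c f E. scale c (f E)"
  subgoal for c f g
    using relation_ideal_scale[of "f E - g E" E c for E]
    by (simp add: leavitt_rel_def free_carrier_scale scale_simps)
  done

lemma smult_add: "smult c (x + y) = smult c x + smult c y"
  and smult_add_scalar: "smult (c + d) x = smult c x + smult d x"
  and smult_smult [simp]: "smult c (smult d x) = smult (c * d) x"
  and smult_1 [simp]: "smult 1 x = x"
  and smult_0_scalar [simp]: "smult 0 x = 0"
  and smult_mult_left [simp]: "smult c x * y = smult c (x * y)"
  and smult_mult_right [simp]: "x * smult c y = smult c (x * y)"
  by (transfer; simp add: scale_simps leavitt_rel_def free_carrier_closed relation_ideal_0)+

lemma smult_0 [simp]: "smult c 0 = 0"
  using smult_add[of c 0 0] by simp

lemma smult_diff: "smult c (x - y) = smult c x - smult c y"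
  using smult_add[of c "x - y" y] by simp

text \<open>Values outside \<open>free_carrier E\<close> are set to zero because the quotient type
  is partial: a representative must lie in the carrier for every graph.\<close>

lift_definition cls :: "('v, 'e) pre_digraph \<Rightarrow> ('v, 'e, 'k::field) free_alg \<Rightarrow> ('v, 'e, 'k) leavitt"
  is "\<lambda>E f E'. if E' = E \<and> f \<in> free_carrier E then f else 0"
  by (simp add: leavitt_rel_def free_carrier_0 relation_ideal_0)

lemma cls_0 [simp]: "cls E 0 = 0"
  by transfer (simp add: leavitt_rel_def free_carrier_0 relation_ideal_0)

lemma cls_add: "f \<in> free_carrier E \<Longrightarrow> g \<in> free_carrier E \<Longrightarrow> cls E (f + g) = cls E f + cls E g"
  and cls_diff: "f \<in> free_carrier E \<Longrightarrow> g \<in> free_carrier E \<Longrightarrow> cls E (f - g) = cls E f - cls E g"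
  and cls_mult: "f \<in> free_carrier E \<Longrightarrow> g \<in> free_carrier E \<Longrightarrow> cls E (f * g) = cls E f * cls E g"
  and cls_uminus: "f \<in> free_carrier E \<Longrightarrow> cls E (- f) = - cls E f"
  and cls_scale: "f \<in> free_carrier E \<Longrightarrow> cls E (scale c f) = smult c (cls E f)"
  by (transfer; simp add: leavitt_rel_def free_carrier_closed relation_ideal_0 scale_0)+

lemma cls_sum: "(\<And>x. x \<in> A \<Longrightarrow> f x \<in> free_carrier E) \<Longrightarrow> cls E (sum f A) = (\<Sum>x\<in>A. cls E (f x))"
  by (induction A rule: infinite_finite_induct) (simp_all add: cls_add free_carrier_sum)

text \<open>The coordinate of \<open>E\<close> detects exactly the relation ideal and all other
  coordinates are zero, so the image of \<open>cls E\<close> is a faithful copy of the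
  algebra.\<close>

lemma cls_eq_iff:
  assumes fg: "f \<in> free_carrier E" "g \<in> free_carrier E"
  shows "cls E f = cls E g \<longleftrightarrow> f - g \<in> leavitt_relation_ideal E"
proof -
  let ?f = "\<lambda>f E'. if E' = E \<and> f \<in> free_carrier E then f else 0"
  have "cls E f = cls E g \<longleftrightarrow> leavitt_rel (?f f) (?f g)" by (transfer fixing: f g E) (rule refl)
  moreover have "leavitt_rel (?f f) (?f g) \<Longrightarrow> f - g \<in> leavitt_relation_ideal E"
    unfolding leavitt_rel_def by (drule spec[of _ E]) (simp add: fg)
  moreover have "leavitt_rel (?f f) (?f g)" if "f - g \<in> leavitt_relation_ideal E"
    using that fg by (simp add: leavitt_rel_def free_carrier_0 relation_ideal_0)
  ultimately show ?thesis by blast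
qed

lemma cls_relator:
  assumes "r \<in> leavitt_relators E" "r \<in> free_carrier E"
  shows "cls E r = 0"
  using cls_eq_iff[of r E 0] assms by (simp add: free_carrier_0 relator_in_relation_ideal)

text \<open>The parameter \<open>K\<close> only serves to fix the type of the coefficient field.\<close>

locale leavitt_algebra = wf_digraph G for G :: "('v, 'e) pre_digraph" (structure) +
  fixes K :: "'k::field itself"
begin

abbreviation \<pi> :: "('v, 'e, 'k) free_alg \<Rightarrow> ('v, 'e, 'k) leavitt" where "\<pi> \<equiv> cls G"
abbreviation V :: "'v \<Rightarrow> ('v, 'e, 'k) leavitt" where "V v \<equiv> \<pi> (vx v)"
abbreviation X :: "'e \<Rightarrow> ('v, 'e, 'k) leavitt" where "X e \<equiv> \<pi> (ed e)"
abbreviation Y :: "'e \<Rightarrow> ('v, 'e, 'k) leavitt" where "Y e \<equiv> \<pi> (gh e)"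

section \<open>Rewriting rules for vertices, edges and ghost edges\<close>

lemma cls_relator_eqI:
  assumes "f - g \<in> leavitt_relators G" "f \<in> free_carrier G" "g \<in> free_carrier G"
  shows "cls G f = cls G g"
  using assms by (simp add: cls_eq_iff relator_in_relation_ideal)

lemma V_idem: "v \<in> verts G \<Longrightarrow> V v * V v = V v"
  using cls_relator_eqI[OF leavitt_relators.idem[of v G]]
  by (simp add: free_carrier_closed cls_mult[symmetric])

lemma V_orth: "v \<in> verts G \<Longrightarrow> w \<in> verts G \<Longrightarrow> v \<noteq> w \<Longrightarrow> V v * V w = 0"
  using cls_relator[OF leavitt_relators.orth[of v G w]]
  by (simp add: free_carrier_closed cls_mult[symmetric])

lemma V_V: "v \<in> verts G \<Longrightarrow> w \<in> verts G \<Longrightarrow> V v * V w = (if v = w then V v else 0)"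
  by (simp add: V_idem V_orth)

text \<open>The relator settles the source vertex. For any other vertex, the source vertex is
  inserted first and orthogonality applies. The next three lemmas follow the same pattern.\<close>

lemma V_X:
  assumes "v \<in> verts G" "e \<in> arcs G"
  shows "V v * X e = (if v = tail G e then X e else 0)"
proof -
  have unit: "V (tail G e) * X e = (X e)"
    using assms cls_relator_eqI[OF leavitt_relators.source_edge[of e G]]
    by (simp add: free_carrier_closed cls_mult[symmetric])
  have "(V v * X e) = V v * V (tail G e) * X e" using unit by (simp add: mult.assoc)
  also have "\<dots> = (if v = tail G e then X e else 0)" using unit assms by (auto simp: V_V)
  finally show ?thesis .
qed

lemma X_V:
  assumes "v \<in> verts G" "e \<in> arcs G"
  shows "X e * V v = (if v = head G e then X e else 0)"
proof -
  have unit: "X e * V (head G e) = (X e)"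
    using assms cls_relator_eqI[OF leavitt_relators.edge_range[of e G]]
    by (simp add: free_carrier_closed cls_mult[symmetric])
  have "(X e * V v) = X e * (V (head G e) * V v)" using unit by (simp flip: mult.assoc)
  also have "\<dots> = (if v = head G e then X e else 0)" using unit assms by (auto simp: V_V)
  finally show ?thesis .
qed

lemma V_Y:
  assumes "v \<in> verts G" "e \<in> arcs G"
  shows "V v * Y e = (if v = head G e then Y e else 0)"
proof -
  have unit: "V (head G e) * Y e = (Y e)"
    using assms cls_relator_eqI[OF leavitt_relators.range_ghost[of e G]]
    by (simp add: free_carrier_closed cls_mult[symmetric])
  have "(V v * Y e) = V v * V (head G e) * Y e" using unit by (simp add: mult.assoc)
  also have "\<dots> = (if v = head G e then Y e else 0)" using unit assms by (auto simp: V_V)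
  finally show ?thesis .
qed

lemma Y_V:
  assumes "v \<in> verts G" "e \<in> arcs G"
  shows "Y e * V v = (if v = tail G e then Y e else 0)"
proof -
  have unit: "Y e * V (tail G e) = (Y e)"
    using assms cls_relator_eqI[OF leavitt_relators.ghost_source[of e G]]
    by (simp add: free_carrier_closed cls_mult[symmetric])
  have "(Y e * V v) = Y e * (V (tail G e) * V v)" using unit by (simp flip: mult.assoc)
  also have "\<dots> = (if v = tail G e then Y e else 0)" using unit assms by (auto simp: V_V)
  finally show ?thesis .
qed

lemma Y_X_same: "e \<in> arcs G \<Longrightarrow> Y e * X e = V (head G e)"
  using cls_relator_eqI[OF leavitt_relators.CK1_same[of e G]]
  by (simp add: free_carrier_closed cls_mult[symmetric])

lemma Y_X_distinct: "e \<in> arcs G \<Longrightarrow> f \<in> arcs G \<Longrightarrow> e \<noteq> f \<Longrightarrow> Y e * X f = 0"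
  using cls_relator[OF leavitt_relators.CK1_distinct[of e G f]]
  by (simp add: free_carrier_closed cls_mult[symmetric])

lemma Y_X: "e \<in> arcs G \<Longrightarrow> f \<in> arcs G \<Longrightarrow> Y e * X f = (if e = f then V (head G e) else 0)"
  by (simp add: Y_X_same Y_X_distinct)

text \<open>Since \<open>mult.assoc\<close> nests products to the right, each rule also needs a form
  with a trailing factor.\<close>

lemma V_V_assoc: "v \<in> verts G \<Longrightarrow> w \<in> verts G \<Longrightarrow> V v * (V w * x) = (if v = w then V v * x else 0)"
  and V_X_assoc: "v \<in> verts G \<Longrightarrow> e \<in> arcs G \<Longrightarrow> V v * (X e * x) = (if v = tail G e then X e * x else 0)"
  and X_V_assoc: "v \<in> verts G \<Longrightarrow> e \<in> arcs G \<Longrightarrow> X e * (V v * x) = (if v = head G e then X e * x else 0)"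
  and V_Y_assoc: "v \<in> verts G \<Longrightarrow> e \<in> arcs G \<Longrightarrow> V v * (Y e * x) = (if v = head G e then Y e * x else 0)"
  and Y_V_assoc: "v \<in> verts G \<Longrightarrow> e \<in> arcs G \<Longrightarrow> Y e * (V v * x) = (if v = tail G e then Y e * x else 0)"
  and Y_X_assoc: "e \<in> arcs G \<Longrightarrow> f \<in> arcs G \<Longrightarrow> Y e * (X f * x) = (if e = f then V (head G e) * x else 0)"
  by (simp_all add: V_V V_X X_V V_Y Y_V Y_X flip: mult.assoc)

lemmas leavitt_simps = V_V V_X X_V V_Y Y_V Y_X V_V_assoc V_X_assoc X_V_assoc V_Y_assoc Y_V_assoc
  Y_X_assoc mult.assoc

end

section \<open>Homogeneous elements of Leavitt path algebras\<close>

context leavitt_algebra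
begin

text \<open>The product \<open>e\<^sub>1 ... e\<^sub>n v f\<^sub>k\<^sup>* ...
  f\<^sub>1\<^sup>*\<close>, so the head of \<open>fs\<close> is the rightmost ghost edge. The edges
  need not compose to paths; a sequence that does not compose gives zero.\<close>

fun monomial :: "'e list \<Rightarrow> 'v \<Rightarrow> 'e list \<Rightarrow> ('v, 'e, 'k) leavitt" where
  "monomial [] v [] = V v"
| "monomial [] v (f # fs) = monomial [] v fs * Y f"
| "monomial (e # es) v fs = X e * monomial es v fs"

lemma monomial_Cons_right: "monomial es v (f # fs) = monomial es v fs * Y f"
  by (induction es) (simp_all add: mult.assoc)

lemma monomial_mult_V:
  assumes "v \<in> verts G" "w \<in> verts G"
  shows "monomial es v [] * V w = (if v = w then monomial es v [] else 0)"
  by (induction es) (use assms in \<open>auto simp: leavitt_simps\<close>)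

lemma monomial_mult_X:
  assumes "v \<in> verts G" "e \<in> arcs G"
  shows "monomial es v [] * X e = (if v = tail G e then monomial (es @ [e]) (head G e) [] else 0)"
  by (induction es) (use assms in \<open>auto simp: leavitt_simps\<close>)

definition monomials :: "int \<Rightarrow> ('v, 'e, 'k) leavitt set" where
  "monomials d = {monomial es v fs | es v fs. set es \<subseteq> arcs G \<and> v \<in> verts G \<and> set fs \<subseteq> arcs G \<and>
     int (length es) - int (length fs) = d}"

lemma monomialsI:
  "m = monomial es v fs \<Longrightarrow> set es \<subseteq> arcs G \<Longrightarrow> v \<in> verts G \<Longrightarrow> set fs \<subseteq> arcs G \<Longrightarrow>
    int (length es) - int (length fs) = d \<Longrightarrow> m \<in> monomials d"
  unfolding monomials_def by blast

lemma gen_monomials: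
  assumes "x \<in> generators G"
  shows "\<pi> (gen x) \<in> monomials (gen_degree x)"
  using assms unfolding generators_def
proof (elim UnE imageE)
  fix v assume "x = Vertex v" "v \<in> verts G"
  then show ?thesis by (intro monomialsI[of _ "[]" v "[]"]) auto
next
  fix e assume "x = Edge e" "e \<in> arcs G"
  then show ?thesis by (intro monomialsI[of _ "[e]" "head G e" "[]"]) (auto simp: leavitt_simps)
next
  fix e assume "x = Ghost e" "e \<in> arcs G"
  then show ?thesis by (intro monomialsI[of _ "[]" "head G e" "[e]"]) (auto simp: leavitt_simps)
qed

text \<open>Up to zero, a vertex on the right is absorbed by the last factor, a ghost edge prolongs
  \<open>fs\<close>, and an edge either prolongs \<open>es\<close> or cancels against the head of
  \<open>fs\<close>.\<close>

lemma monomials_mult_gen: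
  assumes m: "m \<in> monomials d" and x: "x \<in> generators G"
  shows "m * \<pi> (gen x) \<in> insert 0 (monomials (d + gen_degree x))"
proof -
  from m obtain es v fs where m: "m = monomial es v fs" "set es \<subseteq> arcs G" "v \<in> verts G" "set fs \<subseteq> arcs G"
    "int (length es) - int (length fs) = d" by (auto simp: monomials_def)
  from x consider (V) w where "x = Vertex w" "w \<in> verts G" | (X) e where "x = Edge e" "e \<in> arcs G"
    | (Y) e where "x = Ghost e" "e \<in> arcs G" by (auto simp: generators_def)
  then show ?thesis
  proof cases
    case V
    have "m * V w = m \<or> m * V w = 0"
    proof (cases fs)
      case Nil
      then show ?thesis using m V by (simp add: monomial_mult_V)
    next
      case (Cons f fs')
      then show ?thesis using m V by (simp add: monomial_Cons_right leavitt_simps)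
    qed
    then show ?thesis using V assms by auto
  next
    case X
    show ?thesis
    proof (cases fs)
      case Nil
      have "monomial (es @ [e]) (head G e) [] \<in> monomials (d + 1)"
        using m X Nil by (intro monomialsI[of _ "es @ [e]" "head G e" "[]"]) auto
      then show ?thesis using m X Nil by (simp add: monomial_mult_X)
    next
      case (Cons f fs')
      have "monomial es v fs' \<in> monomials (d + 1)"
        using m Cons by (intro monomialsI[of _ es v fs']) auto
      moreover have "m * X e \<in> {0, monomial es v fs'}"
      \<comment> \<open>\<open>Y f * X e\<close> is zero or a vertex, which is then tested against
        the factor before it: \<open>V v\<close> if \<open>fs'\<close> is empty, a ghost edge
        otherwise.\<close>
      proof (cases fs')
        case Nil
        then show ?thesis using m X Cons by (simp add: monomial_Cons_right leavitt_simps monomial_mult_V)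
      next
        case (Cons g gs)
        then show ?thesis using m X \<open>fs = f # fs'\<close> by (simp add: monomial_Cons_right leavitt_simps)
      qed
      ultimately show ?thesis using X by auto
    qed
  next
    case Y
    then have "m * Y e \<in> monomials (d - 1)"
      using m by (intro monomialsI[of _ es v "e # fs"]) (auto simp: monomial_Cons_right)
    with Y show ?thesis by simp
  qed
qed

lemma cls_word:
  "xs \<noteq> [] \<Longrightarrow> set xs \<subseteq> generators G \<Longrightarrow>
    \<pi> (Poly_Mapping.single (Word xs) 1) \<in> insert 0 (monomials (word_degree (Word xs)))"
proof (induction xs rule: rev_nonempty_induct)
  case (single x)
  then show ?case using gen_monomials[of x] by (simp add: gen_def)
next
  case (snoc x xs)
  have "(Poly_Mapping.single (Word (xs @ [x])) 1 :: ('v, 'e, 'k) free_alg) = Poly_Mapping.single (Word xs) 1 * gen x"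
    by (simp add: gen_def mult_single plus_free_monoid_def)
  then have eq: "\<pi> (Poly_Mapping.single (Word (xs @ [x])) 1) =
      \<pi> (Poly_Mapping.single (Word xs) 1) * \<pi> (gen x)"
    using snoc by (simp add: cls_mult free_carrier_single free_carrier_gen)
  show ?case
    using snoc monomials_mult_gen[of _ "word_degree (Word xs)" x] unfolding eq by auto
qed

text \<open>Every class is a linear combination of monomials, and \<open>D\<close> keeps track of
  their degrees; a singleton \<open>D\<close> serves for homogeneous elements.\<close>

lemma cls_induct [consumes 2, case_names zero monomial add]:
  assumes f: "f \<in> free_carrier G" "word_degree ` Poly_Mapping.keys f \<subseteq> D"
    and zero: "P 0" and monomial: "\<And>d m c. d \<in> D \<Longrightarrow> m \<in> monomials d \<Longrightarrow> P (smult c m)"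
    and add: "\<And>x y. P x \<Longrightarrow> P y \<Longrightarrow> P (x + y)"
  shows "P (\<pi> f)"
proof -
  have "f \<in> free_carrier G \<and> P (\<pi> f)"
  proof (induction f rule: poly_mapping_keys_induct)
    case (single w)
    obtain xs where w: "w = Word xs" by (cases w)
    have "letters w \<noteq> [] \<and> set (letters w) \<subseteq> generators G" "word_degree w \<in> D"
      using single f unfolding free_carrier_iff by blast+
    then have xs: "xs \<noteq> []" "set xs \<subseteq> generators G" "word_degree (Word xs) \<in> D"
      unfolding w by simp_all
    have eq: "Poly_Mapping.single w c = scale c (Poly_Mapping.single (Word xs) 1)" for c :: 'k
      using w by (simp add: scale_def mult_single)
    show ?case
      using cls_word[OF xs(1,2)] xs monomial zero unfolding eq
      by (auto simp: cls_scale free_carrier_single free_carrier_scale)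
  qed (auto simp: zero free_carrier_0 cls_add free_carrier_add intro: add)
  then show ?thesis ..
qed

lemma homogeneous_degrees: "homogeneous d f \<Longrightarrow> word_degree ` Poly_Mapping.keys f \<subseteq> {d}"
  by (auto simp: homogeneous_def)

lemma monomial_right_unit:
  assumes "m \<in> monomials d"
  shows "\<exists>v\<in>verts G. m * V v = m"
proof -
  have "\<exists>w\<in>verts G. monomial es v fs * V w = monomial es v fs"
    if "v \<in> verts G" "set fs \<subseteq> arcs G" for es v and fs :: "'e list"
  proof (cases fs)
    case Nil
    then show ?thesis using that by (intro bexI[of _ v]) (simp_all add: monomial_mult_V)
  next
    case (Cons f fs')
    then show ?thesis
      using that by (intro bexI[of _ "tail G f"]) (simp_all add: monomial_Cons_right leavitt_simps)
  qed
  then show ?thesis using assms by (auto simp: monomials_def)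
qed

lemma V_mult_sum_V: "finite B \<Longrightarrow> B \<subseteq> verts G \<Longrightarrow> v \<in> B \<Longrightarrow> V v * (\<Sum>w\<in>B. V w) = V v"
  by (simp add: sum_distrib_left subset_iff V_V sum.delta)

text \<open>A sum of sufficiently many vertices is a local unit.\<close>

lemma right_unit:
  assumes "f \<in> free_carrier G"
  shows "\<exists>u\<in>free_carrier G. \<pi> f * \<pi> u = \<pi> f"
proof -
  \<comment> \<open>The claim covers every finite \<open>B\<close> above \<open>A\<close> so that it
    survives addition: the sets found for two summands are united. The same device recurs for
    \<open>cut\<close>.\<close>
  have "\<exists>A. finite A \<and> A \<subseteq> verts G \<and> (\<forall>B. finite B \<and> A \<subseteq> B \<and> B \<subseteq> verts G \<longrightarrow> \<pi> f * (\<Sum>v\<in>B. V v) = \<pi> f)"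
    using assms subset_UNIV
  proof (induction rule: cls_induct)
    case zero
    then show ?case by (intro exI[of _ "{}"]) simp
  next
    case (monomial d m c)
    then obtain v where v: "v \<in> verts G" "m * V v = m" using monomial_right_unit by blast
    have "smult c m * (\<Sum>w\<in>B. V w) = smult c m" if "finite B" "{v} \<subseteq> B" "B \<subseteq> verts G" for B
    proof -
      have "m * (\<Sum>w\<in>B. V w) = m * (V v * (\<Sum>w\<in>B. V w))" by (simp add: v flip: mult.assoc)
      then show ?thesis using that V_mult_sum_V[of B v] v by simp
    qed
    then show ?case using v by (intro exI[of _ "{v}"]) simp
  next
    case (add x y)
    then obtain A A' where "finite A \<and> A \<subseteq> verts G \<and> (\<forall>B. finite B \<and> A \<subseteq> B \<and> B \<subseteq> verts G \<longrightarrow> x * (\<Sum>v\<in>B. V v) = x)"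
      "finite A' \<and> A' \<subseteq> verts G \<and> (\<forall>B. finite B \<and> A' \<subseteq> B \<and> B \<subseteq> verts G \<longrightarrow> y * (\<Sum>v\<in>B. V v) = y)"
      by blast
    then show ?case by (intro exI[of _ "A \<union> A'"]) (simp add: distrib_right)
  qed
  then obtain A where A: "finite A" "A \<subseteq> verts G" "\<pi> f * (\<Sum>v\<in>A. V v) = \<pi> f" by blast
  have "(\<Sum>v\<in>A. V v) = \<pi> (\<Sum>v\<in>A. vx v)" using A by (intro cls_sum[symmetric]) (auto intro!: free_carrier_gen)
  then show ?thesis using A by (intro bexI[of _ "\<Sum>v\<in>A. vx v"]) (auto intro!: free_carrier_sum free_carrier_gen)
qed

end

section \<open>Graded ideals are idempotent\<close>

context leavitt_algebra
begin

text \<open>For a finite set of arcs this is the idempotent \<open>p\<close>, a sum of orthogonal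
  idempotents \<open>e e\<^sup>*\<close>.\<close>

definition cut :: "'e set \<Rightarrow> ('v, 'e, 'k) leavitt" where
  "cut B = (\<Sum>e\<in>B. X e * Y e)"

lemma cut_mult_X: "finite B \<Longrightarrow> B \<subseteq> arcs G \<Longrightarrow> e \<in> B \<Longrightarrow> cut B * X e = X e"
  by (simp add: cut_def sum_distrib_right subset_iff leavitt_simps if_distrib sum.delta cong: if_cong)

lemma Y_mult_cut: "finite B \<Longrightarrow> B \<subseteq> arcs G \<Longrightarrow> e \<in> B \<Longrightarrow> Y e * cut B = Y e"
  by (simp add: cut_def sum_distrib_left subset_iff leavitt_simps if_distrib sum.delta' cong: if_cong)

lemma cut_idem:
  assumes "finite B" "B \<subseteq> arcs G"
  shows "cut B * cut B = cut B"
proof -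
  have "cut B * cut B = (\<Sum>e\<in>B. cut B * X e * Y e)"
    by (simp add: cut_def[of B] sum_distrib_left mult.assoc)
  also have "\<dots> = cut B" by (simp add: cut_mult_X assms) (simp add: cut_def)
  finally show ?thesis .
qed

text \<open>Each term \<open>e e\<^sup>*\<close> is fixed from both sides by the source of
  \<open>e\<close> and killed from both sides by every other vertex.\<close>

lemma V_cut_commute:
  assumes "B \<subseteq> arcs G" "v \<in> verts G"
  shows "V v * cut B = cut B * V v"
  unfolding cut_def sum_distrib_left sum_distrib_right
  by (rule sum.cong) (use assms in \<open>auto simp: leavitt_simps subset_iff\<close>)

text \<open>Filters the degree zero component by depth. Vertices are present at every level. Scalars
  enter through them, which suffices because scalars pass through products.\<close>

inductive zero_level :: "nat \<Rightarrow> ('v, 'e, 'k) leavitt \<Rightarrow> bool" where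
  zero: "zero_level n 0"
| vertex: "v \<in> verts G \<Longrightarrow> zero_level n (smult c (V v))"
| edge: "zero_level n z \<Longrightarrow> e \<in> arcs G \<Longrightarrow> f \<in> arcs G \<Longrightarrow> zero_level (Suc n) (X e * z * Y f)"
| add: "zero_level n x \<Longrightarrow> zero_level n y \<Longrightarrow> zero_level n (x + y)"

lemma zero_level_mono: "zero_level n x \<Longrightarrow> n \<le> m \<Longrightarrow> zero_level m x"
proof (induction arbitrary: m rule: zero_level.induct)
  case (edge n z e f)
  then obtain m' where "m = Suc m'" "n \<le> m'" by (cases m) auto
  then show ?case using edge by (auto intro: zero_level.edge)
qed (auto intro: zero_level.intros)

lemma zero_level_monomial:
  "length es = length fs \<Longrightarrow> set es \<subseteq> arcs G \<Longrightarrow> v \<in> verts G \<Longrightarrow> set fs \<subseteq> arcs G \<Longrightarrow>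
    zero_level (length es) (smult c (monomial es v fs))"
proof (induction es fs rule: list_induct2)
  case Nil
  then show ?case by (simp add: zero_level.vertex)
next
  case (Cons e es f fs)
  then have "zero_level (Suc (length es)) (X e * smult c (monomial es v fs) * Y f)"
    by (intro zero_level.edge) auto
  then show ?case by (simp add: monomial_Cons_right mult.assoc)
qed

lemma homogeneous_zero_level:
  assumes "f \<in> free_carrier G" "homogeneous 0 f"
  shows "\<exists>n. zero_level n (\<pi> f)"
  using assms(1) homogeneous_degrees[OF assms(2)]
proof (induction rule: cls_induct)
  case zero
  then show ?case by (auto intro: zero_level.zero)
next
  case (monomial d m c)
  then show ?case by (auto simp: monomials_def intro!: zero_level_monomial)
next
  case (add x y)
  then obtain n n' where "zero_level n x" "zero_level n' y" by blast
  then have "zero_level (max n n') (x + y)"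
    by (intro zero_level.add) (auto elim: zero_level_mono)
  then show ?case ..
qed

lemma zero_level_V_mult:
  assumes "zero_level n x" "v \<in> verts G"
  shows "zero_level n (V v * x) \<and> zero_level n (x * V v)"
  using assms(1)
proof induction
  case (vertex w n c)
  then show ?case using assms(2) by (auto simp: V_V intro: zero_level.intros)
next
  case (edge n z e f)
  have "V v * (X e * z * Y f) \<in> {0, X e * z * Y f}" "X e * z * Y f * V v \<in> {0, X e * z * Y f}"
    using edge assms(2) by (auto simp: leavitt_simps)
  moreover have "zero_level (Suc n) (X e * z * Y f)" using edge by (auto intro: zero_level.edge)
  ultimately show ?case using zero_level.zero by force
qed (auto simp: distrib_left distrib_right intro: zero_level.intros)

text \<open>Compression removes the outer layer: \<open>Y e * (X e' * z * Y f') * X f\<close> is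
  zero or \<open>z\<close> between two vertices. This drop in depth drives the induction in
  \<open>zero_level_idem\<close>.\<close>

lemma zero_level_compress:
  assumes "zero_level (Suc n) x" "e \<in> arcs G" "f \<in> arcs G"
  shows "zero_level n (Y e * x * X f)"
  using assms(1)
proof (induction "Suc n" x)
  case (vertex v c)
  have "Y e * smult c (V v) * X f \<in> {0, smult c (V (head G e))}"
    using vertex assms(2,3) by (auto simp: leavitt_simps)
  then show ?case using zero_level.intros(1,2) head_in_verts[OF assms(2)] by fastforce
next
  case (edge z e' f')
  have "Y e * (X e' * z * Y f') * X f \<in> {0, V (head G e) * z * V (head G f)}"
    using edge assms(2,3) by (auto simp: leavitt_simps)
  moreover have "zero_level n (V (head G e) * z * V (head G f))"
    using edge zero_level_V_mult assms(2,3) head_in_verts by blast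
  ultimately show ?case using zero_level.zero by force
qed (auto simp: distrib_left distrib_right intro: zero_level.intros)

text \<open>The span of the idempotents \<open>v - p v\<close>. Coefficients are explicit because
  \<open>vertex_span_regular\<close> inverts them one at a time.\<close>

definition vertex_span :: "'e set \<Rightarrow> ('v, 'e, 'k) leavitt set" where
  "vertex_span B = {\<Sum>v\<in>S. smult (l v) (V v - cut B * V v) | S l. finite S \<and> S \<subseteq> verts G}"

lemma vertex_span_add:
  assumes "x \<in> vertex_span B" "y \<in> vertex_span B"
  shows "x + y \<in> vertex_span B"
proof -
  from assms obtain S l S' l' where x: "x = (\<Sum>v\<in>S. smult (l v) (V v - cut B * V v))" "finite S" "S \<subseteq> verts G"
    and y: "y = (\<Sum>v\<in>S'. smult (l' v) (V v - cut B * V v))" "finite S'" "S' \<subseteq> verts G"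
    unfolding vertex_span_def by blast
  have ext: "(\<Sum>v\<in>S. smult (l v) (g v)) = (\<Sum>v\<in>S \<union> S'. smult (if v \<in> S then l v else 0) (g v))"
    if "finite S" "finite S'" for S S' l and g :: "'v \<Rightarrow> ('v, 'e, 'k) leavitt"
    using that by (intro sum.mono_neutral_cong_left) auto
  have "x + y = (\<Sum>v\<in>S \<union> S'. smult ((if v \<in> S then l v else 0) + (if v \<in> S' then l' v else 0)) (V v - cut B * V v))"
    unfolding x(1) y(1) ext[OF x(2) y(2)] ext[OF y(2) x(2)] Un_commute[of S' S]
    by (simp only: smult_add_scalar sum.distrib)
  then show ?thesis using x y unfolding vertex_span_def
    by (intro CollectI exI[of _ "S \<union> S'"] exI conjI) auto
qed

text \<open>Once \<open>e\<close> and \<open>f\<close> belong to \<open>B\<close>, \<open>p\<close>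
  fixes \<open>e z f\<^sup>*\<close> on both sides and the term cancels; a vertex leaves
  \<open>v - p v\<close> because \<open>p v p = p v\<close>. At depth 0 no arcs are required, so
  \<open>p = 0\<close> is allowed and \<open>x\<close> itself lies in the span.\<close>

lemma zero_level_diff_cut:
  assumes "zero_level n x"
  shows "\<exists>A. finite A \<and> A \<subseteq> arcs G \<and> (n = 0 \<longrightarrow> A = {}) \<and>
    (\<forall>B. finite B \<and> A \<subseteq> B \<and> B \<subseteq> arcs G \<longrightarrow> x - cut B * x * cut B \<in> vertex_span B)"
  using assms
proof induction
  case (zero n)
  have "0 \<in> vertex_span B" for B
    unfolding vertex_span_def by (intro CollectI exI[of _ "{}"]) simp
  then show ?case by (intro exI[of _ "{}"]) simp
next
  case (vertex v n c)
  have "smult c (V v) - cut B * smult c (V v) * cut B \<in> vertex_span B" if "finite B" "B \<subseteq> arcs G" for B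
  proof -
    have "cut B * V v * cut B = cut B * V v"
      using that vertex by (simp add: mult.assoc V_cut_commute) (simp add: cut_idem flip: mult.assoc)
    then have "smult c (V v) - cut B * smult c (V v) * cut B = (\<Sum>w\<in>{v}. smult c (V w - cut B * V w))"
      by (simp add: smult_diff)
    then show ?thesis using vertex unfolding vertex_span_def
      by (intro CollectI exI[of _ "{v}"] exI[of _ "\<lambda>_. c"]) simp
  qed
  then show ?case by (intro exI[of _ "{}"]) simp
next
  case (edge n z e f)
  have "X e * z * Y f - cut B * (X e * z * Y f) * cut B \<in> vertex_span B"
    if "finite B" "{e, f} \<subseteq> B" "B \<subseteq> arcs G" for B
  proof -
    have "cut B * (X e * z * Y f) * cut B = (cut B * X e) * z * (Y f * cut B)" by (simp add: mult.assoc)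
    then have "X e * z * Y f - cut B * (X e * z * Y f) * cut B = 0"
      using that by (simp add: cut_mult_X Y_mult_cut)
    then show ?thesis
      unfolding vertex_span_def by (intro CollectI exI[of _ "{}"]) simp
  qed
  then show ?case using edge by (intro exI[of _ "{e, f}"]) simp
next
  case (add n x y)
  from add.IH(1) obtain A where A: "finite A \<and> A \<subseteq> arcs G \<and> (n = 0 \<longrightarrow> A = {}) \<and>
    (\<forall>B. finite B \<and> A \<subseteq> B \<and> B \<subseteq> arcs G \<longrightarrow> x - cut B * x * cut B \<in> vertex_span B)"
    by (rule exE)
  from add.IH(2) obtain A' where A': "finite A' \<and> A' \<subseteq> arcs G \<and> (n = 0 \<longrightarrow> A' = {}) \<and>
    (\<forall>B. finite B \<and> A' \<subseteq> B \<and> B \<subseteq> arcs G \<longrightarrow> y - cut B * y * cut B \<in> vertex_span B)"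
    by (rule exE)
  have "x + y - cut B * (x + y) * cut B \<in> vertex_span B"
    if "finite B" "A \<union> A' \<subseteq> B" "B \<subseteq> arcs G" for B
  proof -
    have "x + y - cut B * (x + y) * cut B = (x - cut B * x * cut B) + (y - cut B * y * cut B)"
      by (simp add: algebra_simps)
    moreover have "x - cut B * x * cut B \<in> vertex_span B" "y - cut B * y * cut B \<in> vertex_span B"
      using that A A' by simp_all
    ultimately show ?thesis using vertex_span_add by metis
  qed
  then show ?case using A A' by (intro exI[of _ "A \<union> A'"]) simp
qed

text \<open>The elements \<open>v - p v\<close> are orthogonal idempotents, so a combination of them
  is regular; inverting the coefficients and replacing \<open>v - p v\<close> by \<open>v\<close>
  gives \<open>k\<close>.\<close>

lemma vertex_span_regular:
  assumes h: "h \<in> vertex_span B" and B: "finite B" "B \<subseteq> arcs G"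
  shows "\<exists>k\<in>free_carrier G. h * \<pi> k * h = h"
proof -
  define u where "u v = V v - cut B * V v" for v
  from h obtain S l where h: "h = (\<Sum>v\<in>S. smult (l v) (u v))" and S: "finite S" "S \<subseteq> verts G"
    unfolding vertex_span_def u_def by blast
  \<comment> \<open>The convention \<open>inverse 0 = 0\<close> makes
    \<open>l v * (inverse (l v) * l v) = l v\<close> hold for vanishing coefficients too.\<close>
  define k where "k = (\<Sum>v\<in>S. smult (inverse (l v)) (V v))"
  have uV: "u v * V w = (if v = w then u v else 0)" if "v \<in> S" "w \<in> S" for v w
    using that S by (auto simp: u_def left_diff_distrib mult.assoc V_V subset_iff)
  \<comment> \<open>Since \<open>v\<close> commutes with \<open>p\<close>, the product is
    \<open>p v - p p v\<close>, which vanishes.\<close>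
  have u_cut: "u v * cut B = 0" if "v \<in> S" for v
  proof -
    have "V v * cut B = cut B * V v" using that S B V_cut_commute by blast
    then have "u v * cut B = cut B * V v - cut B * cut B * V v"
      by (simp add: u_def left_diff_distrib mult.assoc)
    then show ?thesis using B by (simp add: cut_idem)
  qed
  have uu: "u v * u w = (if v = w then u v else 0)" if "v \<in> S" "w \<in> S" for v w
  proof -
    have "u v * u w = u v * V w - u v * cut B * V w" by (simp add: u_def[of w] right_diff_distrib mult.assoc)
    then show ?thesis using that by (simp add: uV u_cut)
  qed
  have "h * k = (\<Sum>v\<in>S. \<Sum>w\<in>S. smult (inverse (l w) * l v) (u v * V w))"
    by (simp add: h k_def sum_product)
  also have "\<dots> = (\<Sum>v\<in>S. \<Sum>w\<in>S. if v = w then smult (inverse (l v) * l v) (u v) else 0)"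
    by (intro sum.cong) (auto simp: uV)
  also have "\<dots> = (\<Sum>v\<in>S. smult (inverse (l v) * l v) (u v))"
    using S by (simp add: sum.delta)
  finally have "h * k * h = (\<Sum>v\<in>S. \<Sum>w\<in>S. smult (l w * (inverse (l v) * l v)) (u v * u w))"
    by (simp add: h sum_product)
  also have "\<dots> = (\<Sum>v\<in>S. \<Sum>w\<in>S. if v = w then smult (l v * (inverse (l v) * l v)) (u v) else 0)"
    by (intro sum.cong) (auto simp: uu)
  also have "\<dots> = (\<Sum>v\<in>S. smult (l v * (inverse (l v) * l v)) (u v))"
    using S by (simp add: sum.delta)
  also have "\<dots> = h" unfolding h by (intro sum.cong) (auto simp: field_simps)
  finally have "h * k * h = h" .
  moreover have "k = \<pi> (\<Sum>v\<in>S. scale (inverse (l v)) (vx v))"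
    using S by (subst cls_sum) (auto simp: k_def cls_scale free_carrier_closed subset_iff intro!: sum.cong)
  moreover have "(\<Sum>v\<in>S. scale (inverse (l v)) (vx v)) \<in> free_carrier G"
    using S by (auto intro!: free_carrier_closed)
  ultimately show ?thesis by blast
qed

text \<open>Multipliers come only from the factor of \<open>G\<close>, since the ring type also
  contains the factors of other graphs. The set \<open>A\<close> may reach outside the factor of
  \<open>G\<close>, as may \<open>U\<close> and \<open>W\<close> in
  \<open>prime_ideal_elementwise\<close>.\<close>

definition is_ideal :: "('v, 'e, 'k) leavitt set \<Rightarrow> bool" where
  "is_ideal A \<longleftrightarrow> 0 \<in> A \<and> (\<forall>x\<in>A. \<forall>y\<in>A. x + y \<in> A \<and> x - y \<in> A) \<and>
    (\<forall>x\<in>A. \<forall>f\<in>free_carrier G. \<pi> f * x \<in> A \<and> x * \<pi> f \<in> A)"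

lemma ideal_sum: "is_ideal A \<Longrightarrow> (\<And>x. x \<in> S \<Longrightarrow> g x \<in> A) \<Longrightarrow> sum g S \<in> A"
  by (induction S rule: infinite_finite_induct) (auto simp: is_ideal_def)

lemma ideal_XY:
  assumes "is_ideal A" "x \<in> A" "e \<in> arcs G"
  shows "X e * x \<in> A" "x * X e \<in> A" "Y e * x \<in> A" "x * Y e \<in> A"
  using assms by (auto simp: is_ideal_def free_carrier_gen)

text \<open>A monomial of positive degree has more edges than ghost edges, hence begins with an edge
  \<open>e\<close>, and \<open>p e = e\<close> as soon as \<open>e\<close> belongs to
  \<open>B\<close>.\<close>

lemma homogeneous_left_cut:
  assumes "f \<in> free_carrier G" "homogeneous d f" "d > 0"
  shows "\<exists>B. finite B \<and> B \<subseteq> arcs G \<and> cut B * \<pi> f = \<pi> f"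
proof -
  have "\<exists>A. finite A \<and> A \<subseteq> arcs G \<and> (\<forall>B. finite B \<and> A \<subseteq> B \<and> B \<subseteq> arcs G \<longrightarrow> cut B * \<pi> f = \<pi> f)"
    using assms(1) homogeneous_degrees[OF assms(2)]
  proof (induction rule: cls_induct)
    case zero
    then show ?case by (intro exI[of _ "{}"]) simp
  next
    case (monomial d' m c)
    then obtain es v fs where m: "m = monomial es v fs" "set es \<subseteq> arcs G" "int (length es) - int (length fs) = d"
      by (auto simp: monomials_def)
    with assms(3) obtain e es' where "es = e # es'" by (cases es) auto
    then have "\<And>B. finite B \<and> {e} \<subseteq> B \<and> B \<subseteq> arcs G \<longrightarrow> cut B * smult c m = smult c m" "e \<in> arcs G"
      using m by (auto simp: cut_mult_X simp flip: mult.assoc)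
    then show ?case by (intro exI[of _ "{e}"]) simp
  next
    case (add x y)
    then obtain A A' where "finite A \<and> A \<subseteq> arcs G \<and> (\<forall>B. finite B \<and> A \<subseteq> B \<and> B \<subseteq> arcs G \<longrightarrow> cut B * x = x)"
      "finite A' \<and> A' \<subseteq> arcs G \<and> (\<forall>B. finite B \<and> A' \<subseteq> B \<and> B \<subseteq> arcs G \<longrightarrow> cut B * y = y)"
      by blast
    then show ?case by (intro exI[of _ "A \<union> A'"]) (simp add: distrib_left)
  qed
  then show ?thesis by blast
qed

text \<open>Mirror image: in negative degree a monomial ends with a ghost edge, which
  \<open>p\<close> fixes from the right.\<close>

lemma homogeneous_right_cut:
  assumes "f \<in> free_carrier G" "homogeneous d f" "d < 0"
  shows "\<exists>B. finite B \<and> B \<subseteq> arcs G \<and> \<pi> f * cut B = \<pi> f"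
proof -
  have "\<exists>A. finite A \<and> A \<subseteq> arcs G \<and> (\<forall>B. finite B \<and> A \<subseteq> B \<and> B \<subseteq> arcs G \<longrightarrow> \<pi> f * cut B = \<pi> f)"
    using assms(1) homogeneous_degrees[OF assms(2)]
  proof (induction rule: cls_induct)
    case zero
    then show ?case by (intro exI[of _ "{}"]) simp
  next
    case (monomial d' m c)
    then obtain es v fs where m: "m = monomial es v fs" "set fs \<subseteq> arcs G" "int (length es) - int (length fs) = d"
      by (auto simp: monomials_def)
    with assms(3) obtain e fs' where "fs = e # fs'" by (cases fs) auto
    then have "\<And>B. finite B \<and> {e} \<subseteq> B \<and> B \<subseteq> arcs G \<longrightarrow> smult c m * cut B = smult c m" "e \<in> arcs G"
      using m by (auto simp: monomial_Cons_right Y_mult_cut mult.assoc)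
    then show ?case by (intro exI[of _ "{e}"]) simp
  next
    case (add x y)
    then obtain A A' where "finite A \<and> A \<subseteq> arcs G \<and> (\<forall>B. finite B \<and> A \<subseteq> B \<and> B \<subseteq> arcs G \<longrightarrow> x * cut B = x)"
      "finite A' \<and> A' \<subseteq> arcs G \<and> (\<forall>B. finite B \<and> A' \<subseteq> B \<and> B \<subseteq> arcs G \<longrightarrow> y * cut B = y)"
      by blast
    then show ?case by (intro exI[of _ "A \<union> A'"]) (simp add: distrib_right)
  qed
  then show ?thesis by blast
qed

section \<open>Homogeneous elements of an ideal lie in its square\<close>

context
  fixes A D :: "('v, 'e, 'k) leavitt set"
  assumes A: "is_ideal A" and D: "is_ideal D" and AA: "\<And>x y. x \<in> A \<Longrightarrow> y \<in> A \<Longrightarrow> x * y \<in> D"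
begin

text \<open>\<open>D\<close> stands for the square of \<open>A\<close>. An element
  \<open>h = h k h\<close> of \<open>A\<close> lies in \<open>D\<close>, being the product of
  \<open>h k\<close> and \<open>h\<close>. This settles depth 0 and the difference
  \<open>x - p x p\<close>, while \<open>p x p\<close> is reduced to smaller depth.\<close>

lemma zero_level_idem: "zero_level n x \<Longrightarrow> x \<in> A \<Longrightarrow> x \<in> D"
proof (induction n arbitrary: x)
  case (0 x)
  then obtain h where "x - cut {} * x * cut {} \<in> vertex_span {}"
    using zero_level_diff_cut by fastforce
  then have "x \<in> vertex_span {}" by (simp add: cut_def)
  then obtain k where k: "k \<in> free_carrier G" "x * \<pi> k * x = x" using vertex_span_regular[of x "{}"] by auto
  then have "x * \<pi> k \<in> A" using 0 A by (auto simp: is_ideal_def)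
  then show ?case using AA[OF _ 0(2)] k by metis
next
  case (Suc n x)
  obtain B where B: "finite B" "B \<subseteq> arcs G" "x - cut B * x * cut B \<in> vertex_span B"
    using zero_level_diff_cut[OF Suc(2)] by blast
  define h where "h = x - cut B * x * cut B"
  \<comment> \<open>Written out, \<open>p x p\<close> involves \<open>x\<close> only through the
    elements \<open>Y e * x * X f\<close>, which stay in \<open>A\<close> and have level
    \<open>n\<close>.\<close>
  have cut: "cut B * x * cut B = (\<Sum>e\<in>B. \<Sum>f\<in>B. X e * (Y e * x * X f) * Y f)"
    by (simp add: cut_def sum_distrib_left sum_distrib_right mult.assoc) (rule sum.swap)
  have A': "Y e * x * X f \<in> A" if "e \<in> B" "f \<in> B" for e f
    using that B Suc(3) A by (intro ideal_XY) auto
  then have "cut B * x * cut B \<in> A"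
    unfolding cut using B by (intro ideal_sum[OF A] ideal_XY(4)[OF A ideal_XY(1)[OF A]]) auto
  then have "h \<in> A" using Suc(3) A by (simp add: h_def is_ideal_def)
  obtain k where k: "k \<in> free_carrier G" "h * \<pi> k * h = h"
    using vertex_span_regular[OF B(3,1,2)] by (auto simp: h_def)
  then have "h * \<pi> k \<in> A" using \<open>h \<in> A\<close> A by (auto simp: is_ideal_def)
  then have "h \<in> D" using AA[OF _ \<open>h \<in> A\<close>] k by metis
  moreover have "Y e * x * X f \<in> D" if "e \<in> B" "f \<in> B" for e f
    using that B A' Suc.IH zero_level_compress[OF Suc(2)] by blast
  then have "cut B * x * cut B \<in> D"
    unfolding cut using B by (intro ideal_sum[OF D] ideal_XY(4)[OF D ideal_XY(1)[OF D]]) auto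
  moreover have "x = h + cut B * x * cut B" by (simp add: h_def)
  ultimately show ?case using D unfolding is_ideal_def by metis
qed

text \<open>In positive degree \<open>x = p x\<close> is the sum of the products of \<open>e\<close>
  and \<open>e\<^sup>* x\<close>, and \<open>e\<^sup>* x\<close> has degree one less, so the
  induction descends to degree 0.\<close>

lemma homogeneous_idem_nonneg:
  "f \<in> free_carrier G \<Longrightarrow> homogeneous (int n) f \<Longrightarrow> \<pi> f \<in> A \<Longrightarrow> \<pi> f \<in> D"
proof (induction n arbitrary: f)
  case 0
  then show ?case using homogeneous_zero_level zero_level_idem by fastforce
next
  case (Suc n f)
  obtain B where B: "finite B" "B \<subseteq> arcs G" "cut B * \<pi> f = \<pi> f"
    using homogeneous_left_cut[OF Suc(2,3)] by auto
  have "Y e * \<pi> f \<in> D" if e: "e \<in> B" for e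
  proof -
    have "homogeneous (int n) (gh e * f)"
      using homogeneous_mult[OF homogeneous_gen[of "Ghost e"] Suc(3)] by simp
    moreover have "Y e * \<pi> f \<in> A" using ideal_XY(3) A Suc(4) B e by blast
    moreover have "(gh e :: ('v, 'e, 'k) free_alg) \<in> free_carrier G"
      using B e by (intro free_carrier_gen generators_simps) blast
    ultimately show ?thesis using Suc.IH[of "gh e * f"] Suc(2) by (simp add: cls_mult free_carrier_mult)
  qed
  then have "(\<Sum>e\<in>B. X e * (Y e * \<pi> f)) \<in> D"
    using B by (intro ideal_sum[OF D] ideal_XY(1)[OF D]) auto
  moreover have "(\<Sum>e\<in>B. X e * (Y e * \<pi> f)) = \<pi> f"
    using B(3) by (simp add: cut_def sum_distrib_right mult.assoc)
  ultimately show ?case by simp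
qed

text \<open>Mirror image, splitting off ghost edges on the right and raising the degree towards
  0.\<close>

lemma homogeneous_idem_nonpos:
  "f \<in> free_carrier G \<Longrightarrow> homogeneous (- int n) f \<Longrightarrow> \<pi> f \<in> A \<Longrightarrow> \<pi> f \<in> D"
proof (induction n arbitrary: f)
  case 0
  then show ?case using homogeneous_zero_level zero_level_idem by fastforce
next
  case (Suc n f)
  obtain B where B: "finite B" "B \<subseteq> arcs G" "\<pi> f * cut B = \<pi> f"
    using homogeneous_right_cut[OF Suc(2,3)] by auto
  have "\<pi> f * X e \<in> D" if e: "e \<in> B" for e
  proof -
    have "homogeneous (- int n) (f * ed e)"
      using homogeneous_mult[OF Suc(3) homogeneous_gen[of "Edge e"]] by simp
    moreover have "\<pi> f * X e \<in> A" using ideal_XY(2) A Suc(4) B e by blast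
    moreover have "(ed e :: ('v, 'e, 'k) free_alg) \<in> free_carrier G"
      using B e by (intro free_carrier_gen generators_simps) blast
    ultimately show ?thesis using Suc.IH[of "f * ed e"] Suc(2) by (simp add: cls_mult free_carrier_mult)
  qed
  then have "(\<Sum>e\<in>B. (\<pi> f * X e) * Y e) \<in> D"
    using B by (intro ideal_sum[OF D] ideal_XY(4)[OF D]) auto
  moreover have "(\<Sum>e\<in>B. (\<pi> f * X e) * Y e) = \<pi> f"
    using B(3) by (simp add: cut_def sum_distrib_left mult.assoc)
  ultimately show ?case by simp
qed

lemma homogeneous_idem:
  assumes "f \<in> free_carrier G" "homogeneous d f" "\<pi> f \<in> A"
  shows "\<pi> f \<in> D"
proof (cases "d \<ge> 0")
  case True
  then show ?thesis using homogeneous_idem_nonneg[of f "nat d"] assms by simp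
next
  case False
  then show ?thesis using homogeneous_idem_nonpos[of f "nat (- d)"] assms by simp
qed

end

end

section \<open>Ideals of the Leavitt path algebra\<close>

context leavitt_algebra
begin

abbreviation L :: "('v, 'e, 'k) free_alg set ring" where "L \<equiv> leavitt_path_algebra G"

text \<open>The quotient map onto the cosets that make up \<open>L\<close>. The map
  \<open>\<pi>\<close> has the same kernel but lands in the ring type, where calculations take
  place; \<open>q_eq_iff\<close> translates.\<close>

definition q :: "('v, 'e, 'k) free_alg \<Rightarrow> ('v, 'e, 'k) free_alg set" where
  "q f = leavitt_relation_ideal G +>\<^bsub>free_nonunital_alg G\<^esub> f"

lemma q_eq: "q f = (\<lambda>j. j + f) ` leavitt_relation_ideal G"
  by (auto simp: q_def a_r_coset_def r_coset_def free_nonunital_alg_simps)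

lemma q_self: "f \<in> q f"
  unfolding q_eq using relation_ideal_0 by force

lemma q_member: "g \<in> q f \<longleftrightarrow> g - f \<in> leavitt_relation_ideal G"
proof
  assume "g - f \<in> leavitt_relation_ideal G"
  then show "g \<in> q f" unfolding q_eq by (intro image_eqI[of _ _ "g - f"]) simp_all
qed (auto simp: q_eq)

lemma q_eq_iff_diff: "q f = q g \<longleftrightarrow> f - g \<in> leavitt_relation_ideal G"
proof
  assume "q f = q g"
  then show "f - g \<in> leavitt_relation_ideal G" using q_self[of f] by (simp add: q_member)
next
  assume fg: "f - g \<in> leavitt_relation_ideal G"
  have "x - f \<in> leavitt_relation_ideal G \<longleftrightarrow> x - g \<in> leavitt_relation_ideal G" for x
    using relation_ideal_add[OF _ fg, of "x - f"] relation_ideal_diff[OF _ fg, of "x - g"] by auto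
  then show "q f = q g" by (auto simp: q_member)
qed

lemma q_eq_iff: "f \<in> free_carrier G \<Longrightarrow> g \<in> free_carrier G \<Longrightarrow> q f = q g \<longleftrightarrow> \<pi> f = \<pi> g"
  by (simp add: q_eq_iff_diff cls_eq_iff)

lemma q_member_free: "f \<in> free_carrier G \<Longrightarrow> g \<in> q f \<Longrightarrow> g \<in> free_carrier G"
  using relation_ideal_subset free_carrier_add[of "g - f" G f] by (auto simp: q_member)

lemma carrier_L: "carrier L = q ` free_carrier G"
  by (auto simp: leavitt_path_algebra_def FactRing_def A_RCOSETS_defs q_def a_r_coset_def)

lemma zero_L: "\<zero>\<^bsub>L\<^esub> = q 0"
  by (simp add: leavitt_path_algebra_def FactRing_def q_eq)

lemma add_L:
  assumes "f \<in> free_carrier G" "g \<in> free_carrier G"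
  shows "q f \<oplus>\<^bsub>L\<^esub> q g = q (f + g)"
proof -
  have "q f \<oplus>\<^bsub>L\<^esub> q g = {a + b | a b. a \<in> q f \<and> b \<in> q g}"
    by (auto simp: leavitt_path_algebra_def FactRing_def set_add_def set_mult_def free_nonunital_alg_simps)
  also have "\<dots> = q (f + g)"
  proof (intro equalityI subsetI)
    fix x assume "x \<in> {a + b | a b. a \<in> q f \<and> b \<in> q g}"
    then obtain a b where "x = a + b" "a - f \<in> leavitt_relation_ideal G" "b - g \<in> leavitt_relation_ideal G"
      by (auto simp: q_member)
    then show "x \<in> q (f + g)"
      using relation_ideal_add[of "a - f" G "b - g"] by (simp add: q_member algebra_simps)
  next
    fix x assume "x \<in> q (f + g)"
    then have "x = (x - g) + g" "x - g \<in> q f" by (simp_all add: q_member algebra_simps)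
    then show "x \<in> {a + b | a b. a \<in> q f \<and> b \<in> q g}" using q_self by blast
  qed
  finally show ?thesis .
qed

text \<open>The product in a factor ring is a union of cosets over all representatives; as
  \<open>\<pi>\<close> respects products, all of these cosets coincide.\<close>

lemma mult_L:
  assumes "f \<in> free_carrier G" "g \<in> free_carrier G"
  shows "q f \<otimes>\<^bsub>L\<^esub> q g = q (f * g)"
proof -
  have eq: "q (a * b) = q (f * g)" if "a \<in> q f" "b \<in> q g" for a b
  proof -
    have ab: "a \<in> free_carrier G" "b \<in> free_carrier G" using that assms q_member_free by blast+
    then have "\<pi> a = \<pi> f" "\<pi> b = \<pi> g"
      using that assms by (simp_all add: q_member cls_eq_iff)
    then show ?thesis using ab assms by (simp add: q_eq_iff free_carrier_mult cls_mult)
  qed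
  have "q f \<otimes>\<^bsub>L\<^esub> q g = (\<Union>a\<in>q f. \<Union>b\<in>q g. q (a * b))"
    by (simp add: leavitt_path_algebra_def FactRing_def rcoset_mult_def q_def free_nonunital_alg_simps)
  also have "\<dots> = (\<Union>a\<in>q f. \<Union>b\<in>q g. q (f * g))" by (simp only: eq cong: SUP_cong)
  also have "\<dots> = q (f * g)"
  proof -
    have "q f \<noteq> {}" "q g \<noteq> {}" using q_self by blast+
    then show ?thesis by simp
  qed
  finally show ?thesis .
qed

lemma nonunital_ring_L: "nonunital_ring L"
proof -
  have "abelian_group L"
  proof (rule abelian_groupI)
    fix x assume "x \<in> carrier L"
    then obtain f where "x = q f" "f \<in> free_carrier G" by (auto simp: carrier_L)
    then show "\<exists>y\<in>carrier L. y \<oplus>\<^bsub>L\<^esub> x = \<zero>\<^bsub>L\<^esub>"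
      by (intro bexI[of _ "q (- f)"]) (auto simp: carrier_L add_L zero_L free_carrier_uminus)
  qed (auto simp: carrier_L add_L zero_L free_carrier_add free_carrier_0 add_ac)
  then show ?thesis
    by (auto simp: nonunital_ring_def nonunital_ring_axioms_def carrier_L mult_L add_L
        free_carrier_mult free_carrier_add algebra_simps)
qed

sublocale L: nonunital_ring L
  by (rule nonunital_ring_L)

lemma a_inv_L: "f \<in> free_carrier G \<Longrightarrow> \<ominus>\<^bsub>L\<^esub> q f = q (- f)"
  by (rule L.minus_equality) (auto simp: carrier_L add_L zero_L free_carrier_uminus)

lemma finsum_L:
  assumes "finite S" "\<And>n. n \<in> S \<Longrightarrow> g n \<in> free_carrier G"
  shows "finsum L (\<lambda>n. q (g n)) S = q (sum g S)"
  using assms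
proof (induction S)
  case (insert n S)
  then show ?case
    by (subst L.finsum_insert) (auto simp: carrier_L add_L free_carrier_sum)
qed (simp add: zero_L)

text \<open>Carries ideals of \<open>L\<close> over to the ring type; \<open>preimage\<close> goes
  the other way.\<close>

definition image_in_type :: "('v, 'e, 'k) free_alg set set \<Rightarrow> ('v, 'e, 'k) leavitt set" where
  "image_in_type I = {\<pi> f | f. f \<in> free_carrier G \<and> q f \<in> I}"

lemma image_in_type_iff: "f \<in> free_carrier G \<Longrightarrow> \<pi> f \<in> image_in_type I \<longleftrightarrow> q f \<in> I"
  unfolding image_in_type_def mem_Collect_eq by (metis q_eq_iff)

lemma is_ideal_image:
  assumes "two_sided_ideal L I"
  shows "is_ideal (image_in_type I)"
proof -
  have I: "q 0 \<in> I" "\<And>x y. x \<in> I \<Longrightarrow> y \<in> I \<Longrightarrow> x \<oplus>\<^bsub>L\<^esub> y \<in> I" "\<And>x. x \<in> I \<Longrightarrow> \<ominus>\<^bsub>L\<^esub> x \<in> I"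
    "\<And>x a. x \<in> I \<Longrightarrow> a \<in> carrier L \<Longrightarrow> a \<otimes>\<^bsub>L\<^esub> x \<in> I \<and> x \<otimes>\<^bsub>L\<^esub> a \<in> I"
    using assms unfolding L.two_sided_ideal_iff zero_L by blast+
  have "\<pi> 0 \<in> image_in_type I" using I(1) by (subst image_in_type_iff) (auto simp: free_carrier_0)
  moreover have "\<pi> f + \<pi> g \<in> image_in_type I \<and> \<pi> f - \<pi> g \<in> image_in_type I"
    if "f \<in> free_carrier G" "g \<in> free_carrier G" "q f \<in> I" "q g \<in> I" for f g
  proof -
    have "q (f + g) \<in> I" "q (f - g) \<in> I"
      using I(2)[of "q f" "q g"] I(2)[of "q f" "q (- g)"] I(3)[of "q g"] that
      by (simp_all add: add_L a_inv_L free_carrier_uminus)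
    then show ?thesis
      using that image_in_type_iff[of "f + g"] image_in_type_iff[of "f - g"]
      by (simp add: cls_add cls_diff free_carrier_add free_carrier_diff)
  qed
  moreover have "\<pi> g * \<pi> f \<in> image_in_type I \<and> \<pi> f * \<pi> g \<in> image_in_type I"
    if "f \<in> free_carrier G" "g \<in> free_carrier G" "q f \<in> I" for f g
  proof -
    have "q (g * f) \<in> I" "q (f * g) \<in> I"
      using I(4)[of "q f" "q g"] that by (simp_all add: mult_L carrier_L)
    then show ?thesis
      using that image_in_type_iff[of "g * f"] image_in_type_iff[of "f * g"]
      by (simp add: cls_mult free_carrier_mult)
  qed
  ultimately show ?thesis
    unfolding is_ideal_def by (auto simp: image_in_type_def)
qed

lemma two_sided_ideal_LI:
  assumes car: "I \<subseteq> q ` free_carrier G" and zero: "q 0 \<in> I"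
    and add: "\<And>f g. f \<in> free_carrier G \<Longrightarrow> g \<in> free_carrier G \<Longrightarrow> q f \<in> I \<Longrightarrow> q g \<in> I \<Longrightarrow> q (f + g) \<in> I"
    and neg: "\<And>f. f \<in> free_carrier G \<Longrightarrow> q f \<in> I \<Longrightarrow> q (- f) \<in> I"
    and mult: "\<And>f g. f \<in> free_carrier G \<Longrightarrow> g \<in> free_carrier G \<Longrightarrow> q f \<in> I \<Longrightarrow> q (g * f) \<in> I \<and> q (f * g) \<in> I"
  shows "two_sided_ideal L I"
  unfolding L.two_sided_ideal_iff zero_L carrier_L
proof (intro conjI ballI car zero)
  fix x assume x: "x \<in> I"
  with car obtain f where f: "x = q f" "f \<in> free_carrier G" by blast
  show "\<ominus>\<^bsub>L\<^esub> x \<in> I" using neg[of f] x f by (simp add: a_inv_L)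
  show "x \<oplus>\<^bsub>L\<^esub> y \<in> I" if y: "y \<in> I" for y
  proof -
    from car y obtain g where g: "y = q g" "g \<in> free_carrier G" by blast
    then show ?thesis using add[of f g] x y f by (simp add: add_L)
  qed
  fix y assume "y \<in> q ` free_carrier G"
  then obtain g where g: "y = q g" "g \<in> free_carrier G" by blast
  show "y \<otimes>\<^bsub>L\<^esub> x \<in> I" "x \<otimes>\<^bsub>L\<^esub> y \<in> I" using mult[of f g] x f g by (simp_all add: mult_L)
qed

definition preimage :: "('v, 'e, 'k) leavitt set \<Rightarrow> ('v, 'e, 'k) free_alg set set" where
  "preimage U = {q f | f. f \<in> free_carrier G \<and> \<pi> f \<in> U}"

lemma preimage_iff: "f \<in> free_carrier G \<Longrightarrow> q f \<in> preimage U \<longleftrightarrow> \<pi> f \<in> U"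
  unfolding preimage_def mem_Collect_eq by (metis q_eq_iff)

lemma two_sided_ideal_preimage:
  assumes U: "is_ideal U"
  shows "two_sided_ideal L (preimage U)"
proof (rule two_sided_ideal_LI)
  have minus: "- x \<in> U" if "x \<in> U" for x
    using U that unfolding is_ideal_def by (metis diff_0)
  show "preimage U \<subseteq> q ` free_carrier G" by (auto simp: preimage_def)
  show "q 0 \<in> preimage U" using U by (simp add: preimage_iff free_carrier_0 is_ideal_def)
  show "q (- f) \<in> preimage U" if "f \<in> free_carrier G" "q f \<in> preimage U" for f
    using that minus by (simp add: preimage_iff free_carrier_uminus cls_uminus)
qed (use U in \<open>simp_all add: preimage_iff free_carrier_add free_carrier_mult cls_add cls_mult is_ideal_def\<close>)

section \<open>Homogeneous components and graded ideals\<close>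

lemma leavitt_component_eq:
  "leavitt_component G n = {q f | f. f \<in> free_carrier G \<and> homogeneous n f}"
  by (simp add: leavitt_component_def q_def homogeneous_def)

lemma degree_part_cong: "q f = q g \<Longrightarrow> q (degree_part n f) = q (degree_part n g)"
  using degree_part_relation_ideal[of "f - g" n] by (simp add: q_eq_iff_diff degree_part_diff)

text \<open>Taking the part of degree \<open>m\<close> is well defined on classes, and it extracts
  the term of that degree from a sum of homogeneous terms.\<close>

lemma component_unique:
  assumes c: "\<And>n. c n \<in> leavitt_component G n" and fin: "finite {n. c n \<noteq> \<zero>\<^bsub>L\<^esub>}"
    and f: "f \<in> free_carrier G" "q f = finsum L c {n. c n \<noteq> \<zero>\<^bsub>L\<^esub>}"
  shows "c m = q (degree_part m f)"
proof -
  let ?S = "{n. c n \<noteq> \<zero>\<^bsub>L\<^esub>}"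
  have "\<forall>n. \<exists>g. c n = q g \<and> g \<in> free_carrier G \<and> homogeneous n g"
    using c unfolding leavitt_component_eq by blast
  then obtain g where g: "\<And>n. c n = q (g n)" "\<And>n. g n \<in> free_carrier G" "\<And>n. homogeneous n (g n)"
    by metis
  have "q f = q (sum g ?S)" using f(2) finsum_L[of ?S g] fin g(2) unfolding g(1) by simp
  then have "q (degree_part m f) = q (degree_part m (sum g ?S))" by (rule degree_part_cong)
  also have "degree_part m (sum g ?S) = (\<Sum>n\<in>?S. if m = n then g n else 0)"
    by (simp only: degree_part_sum degree_part_homogeneous[OF g(3)])
  also have "\<dots> = (if m \<in> ?S then g m else 0)" using fin by (rule sum.delta')
  also have "q \<dots> = c m" by (simp add: g(1) zero_L)
  finally show ?thesis ..
qed

text \<open>Uniqueness of the decomposition is always given by \<open>component_unique\<close>, so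
  being graded amounts to closure under homogeneous components.\<close>

lemma graded_ideal_iff:
  assumes I: "two_sided_ideal L I"
  shows "graded_ideal L (leavitt_component G) I \<longleftrightarrow>
    (\<forall>f\<in>free_carrier G. q f \<in> I \<longrightarrow> (\<forall>n. q (degree_part n f) \<in> I))"
proof
  assume graded: "graded_ideal L (leavitt_component G) I"
  show "\<forall>f\<in>free_carrier G. q f \<in> I \<longrightarrow> (\<forall>n. q (degree_part n f) \<in> I)"
  proof (intro ballI impI allI)
    fix f n assume f: "f \<in> free_carrier G" "q f \<in> I"
    from graded[unfolded graded_ideal_def] f(2) have "\<exists>!c. (\<forall>n. c n \<in> I \<inter> leavitt_component G n) \<and>
        finite {n. c n \<noteq> \<zero>\<^bsub>L\<^esub>} \<and> q f = finsum L c {n. c n \<noteq> \<zero>\<^bsub>L\<^esub>}"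
      by (elim conjE bspec)
    then obtain c where c: "\<forall>n. c n \<in> I \<inter> leavitt_component G n" "finite {n. c n \<noteq> \<zero>\<^bsub>L\<^esub>}"
      "q f = finsum L c {n. c n \<noteq> \<zero>\<^bsub>L\<^esub>}" by (elim ex1E conjE)
    from c(1) have "c n = q (degree_part n f)" for n
      by (intro component_unique[OF _ c(2) f(1) c(3)]) simp
    then show "q (degree_part n f) \<in> I" using c(1) by (metis Int_iff)
  qed
next
  assume parts: "\<forall>f\<in>free_carrier G. q f \<in> I \<longrightarrow> (\<forall>n. q (degree_part n f) \<in> I)"
  show "graded_ideal L (leavitt_component G) I"
    unfolding graded_ideal_def
  proof (intro conjI ballI I)
    fix x assume x: "x \<in> I"
    then have "x \<in> carrier L" using I by (auto simp: L.two_sided_ideal_iff)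
    then obtain f where f: "x = q f" "f \<in> free_carrier G" by (auto simp: carrier_L)
    let ?c = "\<lambda>n. q (degree_part n f)"
    let ?S = "{n. ?c n \<noteq> \<zero>\<^bsub>L\<^esub>}" and ?D = "word_degree ` Poly_Mapping.keys f"
    \<comment> \<open>A component may be nonzero in the free algebra and vanish in \<open>L\<close>.
      Thus \<open>?S\<close> may be smaller than \<open>?D\<close>, and the remaining components sum
      to an element of the relation ideal.\<close>
    have SD: "?S \<subseteq> ?D" using degree_part_outside[of _ f] by (force simp: zero_L)
    then have fin: "finite ?S" by (rule finite_subset) simp
    have "(\<Sum>n\<in>?D. degree_part n f) = f" by (rule sum_degree_part) auto
    then have "f = (\<Sum>n\<in>?S. degree_part n f) + (\<Sum>n\<in>?D - ?S. degree_part n f)"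
      using sum.subset_diff[OF SD, of "\<lambda>n. degree_part n f"] by (simp add: add.commute)
    moreover have "(\<Sum>n\<in>?D - ?S. degree_part n f) \<in> leavitt_relation_ideal G"
      by (rule relation_ideal_sum) (auto simp: zero_L q_eq_iff_diff)
    ultimately have "q f = q (\<Sum>n\<in>?S. degree_part n f)"
      unfolding q_eq_iff_diff by (metis add_diff_cancel_left')
    then have sum: "q f = finsum L ?c ?S"
      using finsum_L[OF fin, of "\<lambda>n. degree_part n f"] f by (simp add: free_carrier_degree_part)
    have mem: "?c n \<in> I \<inter> leavitt_component G n" for n
      using parts f x homogeneous_degree_part free_carrier_degree_part unfolding leavitt_component_eq by blast
    show "\<exists>!c. (\<forall>n. c n \<in> I \<inter> leavitt_component G n) \<and> finite {n. c n \<noteq> \<zero>\<^bsub>L\<^esub>} \<and>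
        x = finsum L c {n. c n \<noteq> \<zero>\<^bsub>L\<^esub>}"
    proof (rule ex1I[of _ ?c])
      show "(\<forall>n. ?c n \<in> I \<inter> leavitt_component G n) \<and> finite ?S \<and> x = finsum L ?c ?S"
        using mem fin sum f by simp
    next
      fix c assume c: "(\<forall>n. c n \<in> I \<inter> leavitt_component G n) \<and> finite {n. c n \<noteq> \<zero>\<^bsub>L\<^esub>} \<and>
        x = finsum L c {n. c n \<noteq> \<zero>\<^bsub>L\<^esub>}"
      then have "c n = ?c n" for n
        using f by (intro component_unique) (simp_all only: Int_iff)
      then show "c = ?c" by (rule ext)
    qed
  qed
qed

section \<open>The graded core of an ideal and its primeness\<close>

definition graded_core :: "('v, 'e, 'k) free_alg set set \<Rightarrow> ('v, 'e, 'k) free_alg set set" where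
  "graded_core P = {q f | f. f \<in> free_carrier G \<and> (\<forall>n. q (degree_part n f) \<in> P)}"

lemma graded_core_iff: "f \<in> free_carrier G \<Longrightarrow> q f \<in> graded_core P \<longleftrightarrow> (\<forall>n. q (degree_part n f) \<in> P)"
  unfolding graded_core_def mem_Collect_eq by (metis degree_part_cong)

lemma graded_core_iff_image:
  "f \<in> free_carrier G \<Longrightarrow> q f \<in> graded_core P \<longleftrightarrow> (\<forall>n. \<pi> (degree_part n f) \<in> image_in_type P)"
  by (simp add: graded_core_iff image_in_type_iff free_carrier_degree_part)

lemma sum_cls_degree_part:
  assumes "f \<in> free_carrier G"
  shows "\<pi> f = (\<Sum>n\<in>word_degree ` Poly_Mapping.keys f. \<pi> (degree_part n f))"
proof -
  have "\<pi> f = \<pi> (\<Sum>n\<in>word_degree ` Poly_Mapping.keys f. degree_part n f)" by (subst sum_degree_part) auto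
  then show ?thesis using assms by (simp add: cls_sum free_carrier_degree_part)
qed

lemma two_sided_ideal_graded_core:
  assumes "two_sided_ideal L P"
  shows "two_sided_ideal L (graded_core P)"
proof -
  let ?P = "image_in_type P"
  have P: "is_ideal ?P" by (rule is_ideal_image[OF assms])
  have minus: "- x \<in> ?P" if "x \<in> ?P" for x
    using P that unfolding is_ideal_def by (metis diff_0)
  show ?thesis
  proof (rule two_sided_ideal_LI)
    show "graded_core P \<subseteq> q ` free_carrier G" by (auto simp: graded_core_def)
    show "q 0 \<in> graded_core P"
      using P by (subst graded_core_iff_image) (auto simp: free_carrier_0 is_ideal_def)
    show "q (f + g) \<in> graded_core P"
      if "f \<in> free_carrier G" "g \<in> free_carrier G" "q f \<in> graded_core P" "q g \<in> graded_core P" for f g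
      using that P by (simp add: graded_core_iff_image free_carrier_add degree_part_add cls_add
          free_carrier_degree_part is_ideal_def)
    show "q (- f) \<in> graded_core P" if "f \<in> free_carrier G" "q f \<in> graded_core P" for f
      using that minus by (simp add: graded_core_iff_image free_carrier_uminus degree_part_uminus
          cls_uminus free_carrier_degree_part)
    show "q (g * f) \<in> graded_core P \<and> q (f * g) \<in> graded_core P"
      if f: "f \<in> free_carrier G" and g: "g \<in> free_carrier G" and fP: "q f \<in> graded_core P" for f g
    proof -
      have parts: "\<pi> (degree_part n f) \<in> ?P" for n using f fP by (simp add: graded_core_iff_image)
      \<comment> \<open>Both expansions run over the degrees of \<open>g\<close>, and every summand
        has a component of \<open>f\<close> as a factor.\<close>
      have "\<pi> (degree_part n (g * f)) = (\<Sum>i\<in>word_degree ` Poly_Mapping.keys g.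
          \<pi> (degree_part i g) * \<pi> (degree_part (n - i) f))" for n
        unfolding degree_part_mult using f g
        by (subst cls_sum) (simp_all add: cls_mult free_carrier_mult free_carrier_degree_part)
      moreover have "\<pi> (degree_part n (f * g)) = (\<Sum>i\<in>word_degree ` Poly_Mapping.keys g.
          \<pi> (degree_part (n - i) f) * \<pi> (degree_part i g))" for n
        unfolding degree_part_mult' using f g
        by (subst cls_sum) (simp_all add: cls_mult free_carrier_mult free_carrier_degree_part)
      moreover have "\<pi> (degree_part i g) * \<pi> (degree_part j f) \<in> ?P"
        "\<pi> (degree_part j f) * \<pi> (degree_part i g) \<in> ?P" for i j
        using P parts g by (simp_all add: is_ideal_def free_carrier_degree_part)
      ultimately show ?thesis
        using f g by (simp add: graded_core_iff_image free_carrier_mult ideal_sum[OF P])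
    qed
  qed
qed

lemma graded_core_subset:
  assumes "two_sided_ideal L P"
  shows "graded_core P \<subseteq> P"
proof
  fix x assume "x \<in> graded_core P"
  then obtain f where f: "x = q f" "f \<in> free_carrier G" "q f \<in> graded_core P" by (auto simp: graded_core_def)
  then have "\<pi> f \<in> image_in_type P"
    using is_ideal_image[OF assms]
    by (subst sum_cls_degree_part) (auto simp: graded_core_iff_image intro: ideal_sum)
  then show "x \<in> P" using f by (simp add: image_in_type_iff)
qed

lemma graded_ideal_graded_core:
  assumes P: "two_sided_ideal L P"
  shows "graded_ideal L (leavitt_component G) (graded_core P)"
  unfolding graded_ideal_iff[OF two_sided_ideal_graded_core[OF P]]
proof (intro ballI impI allI)
  fix f n assume f: "f \<in> free_carrier G" "q f \<in> graded_core P"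
  have "q 0 \<in> P" using P by (simp add: L.two_sided_ideal_iff zero_L)
  then show "q (degree_part n f) \<in> graded_core P"
    using f by (simp add: graded_core_iff free_carrier_degree_part degree_part_homogeneous[OF homogeneous_degree_part])
qed

lemma graded_ideal_subset_core:
  assumes "graded_ideal L (leavitt_component G) A" "A \<subseteq> P"
  shows "A \<subseteq> graded_core P"
proof
  fix x assume x: "x \<in> A"
  have A: "two_sided_ideal L A" using assms by (simp add: graded_ideal_def)
  with x obtain f where f: "x = q f" "f \<in> free_carrier G" by (auto simp: L.two_sided_ideal_iff carrier_L)
  then have "\<forall>n. q (degree_part n f) \<in> A" using assms(1) x unfolding graded_ideal_iff[OF A] by blast
  then show "x \<in> graded_core P" using f assms(2) by (auto simp: graded_core_iff)
qed

lemma graded_ideal_Int: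
  assumes "graded_ideal L (leavitt_component G) A" "graded_ideal L (leavitt_component G) B"
  shows "graded_ideal L (leavitt_component G) (A \<inter> B)"
proof -
  have AB: "two_sided_ideal L A" "two_sided_ideal L B" using assms by (simp_all add: graded_ideal_def)
  then have "two_sided_ideal L (A \<inter> B)" unfolding L.two_sided_ideal_iff by blast
  then show ?thesis using assms unfolding graded_ideal_iff[OF AB(1)] graded_ideal_iff[OF AB(2)]
    by (simp add: graded_ideal_iff)
qed

text \<open>Each component of an element of \<open>A\<close> lies again in \<open>A\<close>, hence
  in the square by \<open>homogeneous_idem\<close>; the components are then added up.\<close>

lemma graded_ideal_idem:
  assumes "graded_ideal L (leavitt_component G) A"
  shows "A \<subseteq> ideal_prod L A A"
proof
  fix x assume x: "x \<in> A"
  have A: "two_sided_ideal L A" using assms by (simp add: graded_ideal_def)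
  with x obtain f where f: "x = q f" "f \<in> free_carrier G" by (auto simp: L.two_sided_ideal_iff carrier_L)
  let ?A = "image_in_type A" and ?D = "image_in_type (ideal_prod L A A)"
  have ideals: "is_ideal ?A" "is_ideal ?D"
    by (intro is_ideal_image L.two_sided_ideal_ideal_prod A)+
  have AA: "y * z \<in> ?D" if "y \<in> ?A" "z \<in> ?A" for y z
  proof -
    from that obtain g h where gh: "y = \<pi> g" "g \<in> free_carrier G" "q g \<in> A" "z = \<pi> h" "h \<in> free_carrier G" "q h \<in> A"
      by (auto simp: image_in_type_def)
    then have "q (g * h) \<in> ideal_prod L A A" using ideal_prod.prod[of "q g" A "q h" A L] by (simp add: mult_L)
    then have "\<pi> (g * h) \<in> ?D" using gh by (simp add: image_in_type_iff free_carrier_mult)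
    then show ?thesis using gh by (simp add: cls_mult)
  qed
  have "\<pi> (degree_part n f) \<in> ?D" for n
  proof (rule homogeneous_idem[OF ideals AA _ homogeneous_degree_part])
    show "\<pi> (degree_part n f) \<in> ?A"
      using assms x f unfolding graded_ideal_iff[OF A] by (simp add: image_in_type_iff free_carrier_degree_part)
  qed (use f in \<open>simp_all add: free_carrier_degree_part\<close>)
  then have "\<pi> f \<in> ?D" using f ideals by (subst sum_cls_degree_part) (auto intro: ideal_sum)
  then show "x \<in> ideal_prod L A A" using f by (simp add: image_in_type_iff)
qed

text \<open>Primeness is applied to two ideals containing \<open>a\<close> and \<open>b\<close> that
  are easy to describe: \<open>U\<close> consists of the \<open>u\<close> with \<open>u L b\<close>
  inside \<open>P\<close>, and \<open>W\<close> of the \<open>w\<close> with \<open>U L w\<close>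
  inside \<open>P\<close>, where \<open>U\<close> is restricted to classes.\<close>

lemma prime_ideal_elementwise:
  assumes P: "prime_ideal L P" and a: "a \<in> free_carrier G" and b: "b \<in> free_carrier G"
    and ab: "\<And>x. x \<in> free_carrier G \<Longrightarrow> \<pi> a * \<pi> x * \<pi> b \<in> image_in_type P"
  shows "q a \<in> P \<or> q b \<in> P"
proof -
  let ?P = "image_in_type P"
  have ideal: "two_sided_ideal L P" using P by (simp add: prime_ideal_def proper_ideal_def)
  have iP: "is_ideal ?P" by (rule is_ideal_image[OF ideal])
  define U where "U = {u. \<forall>x\<in>free_carrier G. u * \<pi> x * \<pi> b \<in> ?P}"
  define W where "W = {w. \<forall>f\<in>free_carrier G. \<pi> f \<in> U \<longrightarrow> (\<forall>x\<in>free_carrier G. \<pi> f * \<pi> x * w \<in> ?P)}"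
  have "is_ideal U"
    unfolding is_ideal_def
  proof (intro conjI ballI)
    show "0 \<in> U" using iP by (simp add: U_def is_ideal_def)
    fix u assume u: "u \<in> U"
    show "u + v \<in> U" "u - v \<in> U" if "v \<in> U" for v
      using iP u that by (auto simp: U_def is_ideal_def distrib_right left_diff_distrib)
    fix f :: "('v, 'e, 'k) free_alg" assume f: "f \<in> free_carrier G"
    show "\<pi> f * u \<in> U" using iP u f by (auto simp: U_def is_ideal_def mult.assoc)
    have "u * \<pi> f * \<pi> x * \<pi> b = u * \<pi> (f * x) * \<pi> b" if "x \<in> free_carrier G" for x
      using f that by (simp add: cls_mult mult.assoc)
    then show "u * \<pi> f \<in> U" using u f by (auto simp: U_def free_carrier_mult)
  qed
  have "is_ideal W"
    unfolding is_ideal_def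
  proof (intro conjI ballI)
    show "0 \<in> W" using iP by (simp add: W_def is_ideal_def)
    fix w assume w: "w \<in> W"
    show "w + v \<in> W" "w - v \<in> W" if "v \<in> W" for v
      using iP w that by (auto simp: W_def is_ideal_def distrib_left right_diff_distrib)
    fix f :: "('v, 'e, 'k) free_alg" assume f: "f \<in> free_carrier G"
    have "\<pi> g * \<pi> x * (w * \<pi> f) = \<pi> g * \<pi> x * w * \<pi> f" for g x by (simp add: mult.assoc)
    then show "w * \<pi> f \<in> W" using iP w f by (auto simp: W_def is_ideal_def)
    have "\<pi> g * \<pi> x * (\<pi> f * w) = \<pi> g * \<pi> (x * f) * w" if "x \<in> free_carrier G" for g x
      using f that by (simp add: cls_mult mult.assoc)
    then show "\<pi> f * w \<in> W" using w f by (auto simp: W_def free_carrier_mult)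
  qed
  have "ideal_prod L (preimage U) (preimage W) \<subseteq> P"
  proof
    fix z assume "z \<in> ideal_prod L (preimage U) (preimage W)"
    then show "z \<in> P"
    proof induction
      case (prod i j)
      then obtain f g where f: "i = q f" "f \<in> free_carrier G" "\<pi> f \<in> U"
        and g: "j = q g" "g \<in> free_carrier G" "\<pi> g \<in> W" by (auto simp: preimage_def)
      \<comment> \<open>Membership in \<open>W\<close> controls only products with a factor in
        between, so a local unit of \<open>f\<close> is inserted.\<close>
      obtain u where u: "u \<in> free_carrier G" "\<pi> f * \<pi> u = \<pi> f" using right_unit[OF f(2)] by blast
      have "\<pi> f * \<pi> u * \<pi> g \<in> ?P" using f g u(1) unfolding W_def by blast
      then have "\<pi> (f * g) \<in> ?P" using u f g by (simp add: cls_mult)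
      then show ?case using f g by (simp add: image_in_type_iff free_carrier_mult mult_L)
    next
      case (sum s t)
      then show ?case using ideal unfolding L.two_sided_ideal_iff by blast
    qed
  qed
  then have "preimage U \<subseteq> P \<or> preimage W \<subseteq> P"
    using P two_sided_ideal_preimage[OF \<open>is_ideal U\<close>] two_sided_ideal_preimage[OF \<open>is_ideal W\<close>]
    unfolding prime_ideal_def by blast
  moreover have "q a \<in> preimage U" using a ab by (simp add: preimage_iff U_def)
  moreover have "q b \<in> preimage W" using b by (simp add: preimage_iff W_def U_def)
  ultimately show ?thesis by blast
qed

text \<open>
  Compare the components of highest degree outside \<open>P\<close>: in a product \<open>a x b\<close> with \<open>x\<close> homogeneous,
  theirs is the only contribution to the top degree that does not obviously lie in \<open>P\<close>.
\<close>

lemma prime_ideal_graded_core: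
  assumes P: "prime_ideal L P"
  shows "prime_ideal L (graded_core P)"
proof -
  let ?P = "image_in_type P"
  have proper: "two_sided_ideal L P" "P \<noteq> carrier L" using P by (auto simp: prime_ideal_def proper_ideal_def)
  have iP: "is_ideal ?P" by (rule is_ideal_image[OF proper(1)])
  have "graded_core P \<noteq> carrier L"
    using graded_core_subset[OF proper(1)] proper by (auto simp: L.two_sided_ideal_iff)
  then have proper_core: "proper_ideal L (graded_core P)"
    using two_sided_ideal_graded_core[OF proper(1)] by (simp add: proper_ideal_def)
  \<comment> \<open>Finitely many components lie outside \<open>P\<close>, and at least one does;
    the highest is taken.\<close>
  have top: "\<exists>s. \<pi> (degree_part s a) \<notin> ?P \<and> (\<forall>n>s. \<pi> (degree_part n a) \<in> ?P)"
    if "a \<in> free_carrier G" "q a \<notin> graded_core P" for a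
  proof -
    let ?N = "{n. \<pi> (degree_part n a) \<notin> ?P}"
    have "?N \<subseteq> word_degree ` Poly_Mapping.keys a"
    proof
      fix n assume "n \<in> ?N"
      then show "n \<in> word_degree ` Poly_Mapping.keys a"
        using degree_part_outside[of n a] iP by (cases "n \<in> word_degree ` Poly_Mapping.keys a") (auto simp: is_ideal_def)
    qed
    then have fin: "finite ?N" by (rule finite_subset) simp
    moreover have ne: "?N \<noteq> {}" using that by (simp add: graded_core_iff_image)
    ultimately have "Max ?N \<in> ?N" by (rule Max_in)
    moreover have "\<pi> (degree_part n a) \<in> ?P" if "n > Max ?N" for n
      using Max_ge[OF fin, of n] that by fastforce
    ultimately show ?thesis by blast
  qed
  have "A \<subseteq> graded_core P \<or> B \<subseteq> graded_core P"
    if A: "two_sided_ideal L A" and B: "two_sided_ideal L B" and AB: "ideal_prod L A B \<subseteq> graded_core P" for A B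
  proof (rule ccontr)
    assume "\<not> (A \<subseteq> graded_core P \<or> B \<subseteq> graded_core P)"
    moreover have "A \<subseteq> q ` free_carrier G" "B \<subseteq> q ` free_carrier G"
      using A B by (simp_all add: L.two_sided_ideal_iff carrier_L)
    ultimately obtain a b where a: "a \<in> free_carrier G" "q a \<in> A" "q a \<notin> graded_core P"
      and b: "b \<in> free_carrier G" "q b \<in> B" "q b \<notin> graded_core P" by blast
    obtain s where s: "\<pi> (degree_part s a) \<notin> ?P" "\<And>n. n > s \<Longrightarrow> \<pi> (degree_part n a) \<in> ?P"
      using top[OF a(1,3)] by blast
    obtain t where t: "\<pi> (degree_part t b) \<notin> ?P" "\<And>n. n > t \<Longrightarrow> \<pi> (degree_part n b) \<in> ?P"
      using top[OF b(1,3)] by blast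
    have homogeneous_case: "\<pi> (degree_part s a) * \<pi> x * \<pi> (degree_part t b) \<in> ?P"
      if x: "x \<in> free_carrier G" "homogeneous d x" for x d
    proof -
      \<comment> \<open>In degree \<open>?N\<close> the component of \<open>a\<close> of degree
        \<open>s\<close> is paired through \<open>x\<close> with that of \<open>b\<close> of degree
        \<open>t\<close>.\<close>
      let ?N = "s + d + t" and ?D = "word_degree ` Poly_Mapping.keys a"
      have "q a \<otimes>\<^bsub>L\<^esub> q x \<in> A" using A a(2) x(1) by (simp add: L.two_sided_ideal_iff carrier_L)
      then have "(q a \<otimes>\<^bsub>L\<^esub> q x) \<otimes>\<^bsub>L\<^esub> q b \<in> graded_core P"
        using b(2) by (intro subsetD[OF AB] ideal_prod.prod)
      then have "q (a * (x * b)) \<in> graded_core P"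
        using a b x by (simp add: mult_L free_carrier_mult mult.assoc)
      then have "\<pi> (degree_part ?N (a * (x * b))) \<in> ?P"
        using a b x by (simp add: graded_core_iff_image free_carrier_mult)
      moreover have "\<pi> (degree_part ?N (a * (x * b))) =
          (\<Sum>i\<in>?D. \<pi> (degree_part i a) * \<pi> x * \<pi> (degree_part (?N - i - d) b))"
        unfolding degree_part_mult[of _ a] degree_part_mult_left[OF x(2)] using a b x
        by (subst cls_sum) (simp_all add: cls_mult free_carrier_mult free_carrier_degree_part mult.assoc)
      ultimately have total: "(\<Sum>i\<in>?D. \<pi> (degree_part i a) * \<pi> x * \<pi> (degree_part (?N - i - d) b)) \<in> ?P"
        by simp
      have "s \<in> ?D"
        using s(1) degree_part_outside[of s a] iP by (cases "s \<in> ?D") (auto simp: is_ideal_def)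
      then have split: "(\<Sum>i\<in>?D. \<pi> (degree_part i a) * \<pi> x * \<pi> (degree_part (?N - i - d) b)) =
          \<pi> (degree_part s a) * \<pi> x * \<pi> (degree_part t b) +
          (\<Sum>i\<in>?D - {s}. \<pi> (degree_part i a) * \<pi> x * \<pi> (degree_part (?N - i - d) b))"
        by (subst sum.remove[of _ s]) simp_all
      have "(\<Sum>i\<in>?D - {s}. \<pi> (degree_part i a) * \<pi> x * \<pi> (degree_part (?N - i - d) b)) \<in> ?P"
        (is "?r \<in> _")
      proof (rule ideal_sum[OF iP])
        fix i assume "i \<in> ?D - {s}"
        \<comment> \<open>The degrees of the two outer components sum to \<open>s + t\<close>, so
          \<open>i < s\<close> pushes the degree on the side of \<open>b\<close> above
          \<open>t\<close>.\<close>
        then consider "i > s" | "?N - i - d > t" by fastforce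
        then show "\<pi> (degree_part i a) * \<pi> x * \<pi> (degree_part (?N - i - d) b) \<in> ?P"
        proof cases
          case 1
          then show ?thesis using s(2) iP x b by (simp add: is_ideal_def free_carrier_degree_part)
        next
          case 2
          then show ?thesis using t(2) iP x a by (simp add: is_ideal_def free_carrier_degree_part mult.assoc)
        qed
      qed
      then have "\<pi> (degree_part s a) * \<pi> x * \<pi> (degree_part t b) + ?r - ?r \<in> ?P"
        using total iP unfolding split is_ideal_def by blast
      then show ?thesis by simp
    qed
    have "\<pi> (degree_part s a) * \<pi> x * \<pi> (degree_part t b) \<in> ?P" if x: "x \<in> free_carrier G" for x
    proof -
      have "\<pi> (degree_part s a) * \<pi> x * \<pi> (degree_part t b) =
          (\<Sum>n\<in>word_degree ` Poly_Mapping.keys x. \<pi> (degree_part s a) * \<pi> (degree_part n x) * \<pi> (degree_part t b))"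
        by (subst sum_cls_degree_part[OF x]) (simp add: sum_distrib_left sum_distrib_right)
      then show ?thesis
        using x homogeneous_case[OF _ homogeneous_degree_part]
        by (simp add: ideal_sum[OF iP] free_carrier_degree_part)
    qed
    then have "q (degree_part s a) \<in> P \<or> q (degree_part t b) \<in> P"
      using prime_ideal_elementwise[OF P] a b by (simp add: free_carrier_degree_part)
    then show False using s(1) t(1) a b by (simp add: image_in_type_iff free_carrier_degree_part)
  qed
  then show ?thesis using proper_core by (auto simp: prime_ideal_def)
qed

lemma graded_ideal_system_L: "graded_ideal_system L (graded_ideal L (leavitt_component G)) graded_core"
proof (intro graded_ideal_system.intro graded_ideal_system_axioms.intro nonunital_ring_L)
  show "two_sided_ideal L A" if "graded_ideal L (leavitt_component G) A" for A
    using that by (simp add: graded_ideal_def)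
  show "graded_ideal L (leavitt_component G) (A \<inter> B)"
    if "graded_ideal L (leavitt_component G) A" "graded_ideal L (leavitt_component G) B" for A B
    using that by (rule graded_ideal_Int)
  show "A \<subseteq> ideal_prod L A A" if "graded_ideal L (leavitt_component G) A" for A
    using that by (rule graded_ideal_idem)
  show "graded_ideal L (leavitt_component G) (graded_core P)" if "two_sided_ideal L P" for P
    using that by (rule graded_ideal_graded_core)
  show "graded_core P \<subseteq> P" if "two_sided_ideal L P" for P
    using that by (rule graded_core_subset)
  show "A \<subseteq> graded_core P" if "graded_ideal L (leavitt_component G) A" "A \<subseteq> P" for A P
    using that by (rule graded_ideal_subset_core)
  show "prime_ideal L (graded_core P)" if "prime_ideal L P" for P
    using that by (rule prime_ideal_graded_core)
qed

end

theorem theorem3p3: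
  fixes E :: "('v, 'e) pre_digraph"
    and L :: "('v, 'e, 'k::field) free_alg set ring"
    and I :: "('v, 'e, 'k) free_alg set set"
  assumes "wf_digraph E"
    and "L = leavitt_path_algebra E"
    and "proper_ideal L I"
    and "graded_ideal L (leavitt_component E) I"
  shows "(\<forall>Ps. irredundant_prime_product L I Ps \<longrightarrow>
            (\<forall>P\<in>set Ps. graded_ideal L (leavitt_component E) P) \<and> I = \<Inter>(set Ps)) \<and>
         (\<forall>Ps Qs. irredundant_prime_product L I Ps \<and> irredundant_prime_product L I Qs \<longrightarrow>
            length Ps = length Qs \<and> set Ps = set Qs)"
proof -
  have "leavitt_algebra E" using assms(1) by (rule leavitt_algebra.intro)
  \<comment> \<open>The locale predicate does not mention the coefficient field, so its type is
    instantiated by hand.\<close>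
  note system = leavitt_algebra.graded_ideal_system_L[OF this, where ?'k = 'k]
  note I = assms(3,4)[unfolded assms(2)]
  note graded = graded_ideal_system.irredundant_prime_product_graded[OF system I]
    and unique = graded_ideal_system.irredundant_prime_products_unique[OF system I]
  show ?thesis
    unfolding assms(2)
  proof (rule conjI; intro allI impI)
    fix Ps assume irr: "irredundant_prime_product (leavitt_path_algebra E) I Ps"
    show "(\<forall>P\<in>set Ps. graded_ideal (leavitt_path_algebra E) (leavitt_component E) P) \<and> I = \<Inter>(set Ps)"
      by (rule conjI[OF graded[OF irr, THEN conjunct1] graded[OF irr, THEN conjunct2, THEN conjunct1]])
  next
    fix Ps Qs
    assume "irredundant_prime_product (leavitt_path_algebra E) I Ps \<and>
      irredundant_prime_product (leavitt_path_algebra E) I Qs"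
    then show "length Ps = length Qs \<and> set Ps = set Qs" by (elim conjE) (rule unique)
  qed
qed

end
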